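(* Let $d\ge1$ be an integer, $q\in(0,\infty)$, and $x\in\mathbb{Z}^d\setminus\{0\}$. Let $(a_n)_{n\ge1}$ be a sequence in $(0,\infty)$ with $a_n\to 0$, $a_n n\to\infty$ and $a_n^3 n\to 0$ as $n\to\infty$. Then, as $n\to\infty$, $$ C_{a_n}^{(q)}(nx) \sim c_{0,q}\, \frac{(\sqrt{2d}\,a_n)^{(d-1-2q)/2}}{(n\|x\|_2)^{(d+1-2q)/2}}\; e^{-\sqrt{2d}\, a_n n\,\|x\|_2}, \qquad c_{0,q}=\frac{d^q}{(2\pi)^{(d-1)/2}\,\Gamma(q)} . $$
   Context: $f(n)\sim g(n)$ means $\lim_{n\to\infty} f(n)/g(n)=1$. For $x\in\mathbb{Z}^d$, $q>0$, $a>0$, the lattice Green function is $$ C_a^{(q)}(x) = \int_{[-\pi,\pi]^d} \frac{e^{ik\cdot x}}{(a^2+1-\hat D(k))^q}\,\frac{dk}{(2\pi)^d}, \qquad \hat D(k)=\frac1d\sum_{j=1}^d \cos k_j . $$ *)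

theory Defs
  imports "HOL-Analysis.Analysis" "HOL-Library.Landau_Symbols"
begin

text \<open>The lattice \<open>\<int>\<^sup>d\<close> is \<open>int ^ 'd\<close> with \<open>d = CARD('d)\<close>, so \<open>d \<ge> 1\<close> holds automatically.\<close>

definition real_vec :: "int ^ 'd \<Rightarrow> real ^ 'd" where
  "real_vec x = (\<chi> i. real_of_int (x $ i))"

definition D_hat :: "real ^ 'd \<Rightarrow> real" where
  "D_hat k = (1 / real CARD('d)) * (\<Sum>j\<in>UNIV. cos (k $ j))"

definition torus_box :: "(real ^ 'd) set" where
  "torus_box = {k. \<forall>i. - pi \<le> k $ i \<and> k $ i \<le> pi}"

definition lattice_green :: "real \<Rightarrow> real \<Rightarrow> int ^ 'd \<Rightarrow> complex" where
  "lattice_green q a x =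
     (LINT k:torus_box|lborel.
        exp (\<i> * complex_of_real (k \<bullet> real_vec x))
          / complex_of_real ((a\<^sup>2 + 1 - D_hat k) powr q))
     / complex_of_real ((2 * pi) ^ CARD('d))"

definition green_const :: "nat \<Rightarrow> real \<Rightarrow> real" where
  "green_const d q = real d powr q / ((2 * pi) powr ((real d - 1) / 2) * Gamma q)"

end

(*
  Writing the power of the resolvent as a Gamma integral turns the Green function into
  the integral of t^(q-1) e^(-a^2 t) prod_j G(x_j, t/d) over t > 0, where G(m,s) is the Fourier
  coefficient of e^(-s(1 - cos theta)).  Shifting the contour of G to its saddle point factors out
  exp(-s rate(m/s)) exactly; the remaining integral is bounded by a constant times s^(-1/2), with
  the Gaussian asymptotics when s -> infinity and m/s -> 0.  Since rate(v) = v^2/2 + O(v^4), the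
  t-integral is, up to an error of order a^3 n in the exponent, that of
  exp(-(N/2)(tau + 1/tau)) with N = sqrt(2d) a n |x|, and Laplace's method at tau = 1 (dominated
  convergence in z, where tau = 1 + z / sqrt N) gives the claim.
*)
theory Submission
  imports Defs "HOL-Complex_Analysis.Cauchy_Integral_Theorem" "HOL-Probability.Distributions" "HOL-Real_Asymp.Real_Asymp"
begin

text \<open>Write R = n |x|, b = sqrt(2d) a, N = b R. In the rescaled variable tau, the j-th factor
  has time s = R tau / b and slope m/s = b e_j / tau, so near tau = 1 the quartic term of the rate
  costs s (m/s)^4, of order b^3 R: this is where the condition on a^3 n enters. The obstacle is
  uniformity as tau tends to 0, where the slope is unbounded. There v^2/2 - v^4/24 is useless
  (negative once v^2 > 12), the d factors s^(-1/2) together blow up like tau^(-d/2), and tau^(q-1)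
  is itself singular if q < 1. The rate therefore also gets a global lower bound of linear growth,
  v^2 / (2 (1 + |v|)), which keeps the exponent above N / (2 (tau + b)) - N. The integral is cut at
  tau = 1/8: the lower piece is O(exp(-N/2)) after the factor exp(-N) has been split off, and on the
  upper piece the quartic error is at most 1, which leaves a dominating function exp(-|z|/4). All
  bounds on the shifted integral are uniform in m, because some coordinates of x may vanish while
  others grow with n.\<close>

text \<open>The Legendre transform of cosh u - 1, that is, the large deviation rate function of the
  continuous-time simple random walk on the integers; the supremum is attained at u =
  \<open>arsinh v\<close>.\<close>

definition rate :: "real \<Rightarrow> real" where
  "rate v = v * arsinh v - sqrt (1 + v\<^sup>2) + 1"

text \<open>In terms of the modified Bessel function this is 2 pi exp(-s) I_m(s), or 2 pi times the
  probability that the rate-one walk started at 0 is at m at time s.\<close>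

definition fourier_exp_cos :: "int \<Rightarrow> real \<Rightarrow> complex" where
  "fourier_exp_cos m s = (LINT \<theta>:{-pi..pi}|lborel. exp (\<i> * of_real (of_int m * \<theta>) - of_real (s * (1 - cos \<theta>))))"

text \<open>What is left of \<open>fourier_exp_cos\<close> after the contour shift, normalised to have modulus at most 1.\<close>

definition tilted :: "real \<Rightarrow> real \<Rightarrow> complex" where
  "tilted m s = (LINT \<theta>:{-pi..pi}|lborel.
     exp (\<i> * of_real (m * (\<theta> - sin \<theta>)) - of_real (sqrt (s\<^sup>2 + m\<^sup>2) * (1 - cos \<theta>)))) / of_real (2 * pi)"

section \<open>Elementary bounds for the rate function\<close>

lemma DERIV_rate: "(rate has_real_derivative arsinh v) (at v)"
proof -
  have "1 + v\<^sup>2 > 0" by (smt (verit) zero_le_power2)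
  then show ?thesis
    unfolding rate_def by (auto intro!: derivative_eq_intros simp: field_simps)
qed

lemma nonneg_of_deriv_nonneg:
  fixes f :: "real \<Rightarrow> real"
  assumes "f 0 = 0" "\<And>v. v \<ge> 0 \<Longrightarrow> (f has_real_derivative f' v) (at v)"
    "\<And>v. v \<ge> 0 \<Longrightarrow> f' v \<ge> 0" "v \<ge> 0"
  shows "f v \<ge> 0"
  using DERIV_nonneg_imp_nondecreasing[of 0 v f] assms by (metis atLeastAtMost_iff)

lemma one_le_sqrt: "1 \<le> sqrt (v\<^sup>2 + 1)"
  by simp

lemma arsinh_le:
  assumes "v \<ge> (0::real)" shows "arsinh v \<le> v"
proof -
  have "v - arsinh v \<ge> 0"
  proof (rule nonneg_of_deriv_nonneg[where f="\<lambda>v. v - arsinh v" and f'="\<lambda>v. 1 - 1 / sqrt (v\<^sup>2 + 1)"])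
    show "((\<lambda>v. v - arsinh v) has_real_derivative 1 - 1 / sqrt (v\<^sup>2 + 1)) (at v)" for v :: real
      by (auto intro!: derivative_eq_intros)
    show "0 \<le> 1 - 1 / sqrt (v\<^sup>2 + 1)" for v :: real
    proof -
      have "1 / sqrt (v\<^sup>2 + 1) \<le> 1 / 1"
        using one_le_sqrt[of v] by (intro divide_left_mono) (auto intro!: add_nonneg_pos)
      then show ?thesis by simp
    qed
  qed (use assms in auto)
  then show ?thesis by simp
qed

lemma arsinh_ge:
  assumes "v \<ge> (0::real)" shows "arsinh v \<ge> v - v ^ 3 / 6"
proof -
  have "arsinh v - (v - v ^ 3 / 6) \<ge> 0"
  proof (rule nonneg_of_deriv_nonneg[where f="\<lambda>v. arsinh v - (v - v ^ 3 / 6)" and f'="\<lambda>v. 1 / sqrt (v\<^sup>2 + 1) - (1 - v\<^sup>2 / 2)"])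
    show "((\<lambda>v. arsinh v - (v - v ^ 3 / 6)) has_real_derivative 1 / sqrt (v\<^sup>2 + 1) - (1 - v\<^sup>2 / 2)) (at v)" for v :: real
      by (auto intro!: derivative_eq_intros)
    fix v :: real
    have "sqrt (v\<^sup>2 + 1) \<le> 1 + v\<^sup>2 / 2"
    proof (rule real_le_lsqrt)
      have "(1 + v\<^sup>2 / 2)\<^sup>2 = (v\<^sup>2 + 1) + (v\<^sup>2 / 2)\<^sup>2"
        by (simp add: power2_eq_square algebra_simps)
      then show "v\<^sup>2 + 1 \<le> (1 + v\<^sup>2 / 2)\<^sup>2" by simp
    qed (auto intro: add_nonneg_nonneg)
    then have "1 / sqrt (v\<^sup>2 + 1) \<ge> 1 / (1 + v\<^sup>2 / 2)"
      using one_le_sqrt[of v] by (intro divide_left_mono mult_pos_pos) (auto intro: add_pos_nonneg add_nonneg_pos)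
    moreover have "1 / (1 + v\<^sup>2 / 2) \<ge> 1 - v\<^sup>2 / 2"
    proof -
      have "(1 - v\<^sup>2 / 2) * (1 + v\<^sup>2 / 2) = 1 - (v\<^sup>2 / 2)\<^sup>2"
        by (simp add: power2_eq_square algebra_simps)
      then have "(1 - v\<^sup>2 / 2) * (1 + v\<^sup>2 / 2) \<le> 1" by simp
      moreover have "1 + v\<^sup>2 / 2 > 0" by (intro add_pos_nonneg) auto
      ultimately show ?thesis by (simp add: pos_le_divide_eq)
    qed
    ultimately show "0 \<le> 1 / sqrt (v\<^sup>2 + 1) - (1 - v\<^sup>2 / 2)" by simp
  qed (use assms in auto)
  then show ?thesis by simp
qed

text \<open>The right-hand side is the derivative of v^2 / (2 (1 + v)), so integrating this
  inequality gives the global lower bound for \<open>rate\<close>.\<close>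

lemma arsinh_ge_rational:
  assumes "v \<ge> (0::real)" shows "arsinh v \<ge> (1 - inverse ((v + 1)\<^sup>2)) / 2"
proof -
  have "arsinh v - (1 - inverse ((v + 1)\<^sup>2)) / 2 \<ge> 0"
  proof (rule nonneg_of_deriv_nonneg[where f="\<lambda>v. arsinh v - (1 - inverse ((v + 1)\<^sup>2)) / 2"
        and f'="\<lambda>v. 1 / sqrt (v\<^sup>2 + 1) - inverse ((v + 1) ^ 3)"])
    fix v :: real assume v: "v \<ge> 0"
    have "((\<lambda>w. (1 - inverse (w\<^sup>2)) / 2) has_real_derivative inverse (w ^ 3)) (at w)" if "w > 0" for w
      using that by (auto intro!: derivative_eq_intros simp: field_simps power2_eq_square power3_eq_cube)
    then have "((\<lambda>v. (1 - inverse ((v + 1)\<^sup>2)) / 2) has_real_derivative inverse ((v + 1) ^ 3)) (at v)"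
      using v by (intro DERIV_shift[THEN iffD1]) auto
    then show "((\<lambda>v. arsinh v - (1 - inverse ((v + 1)\<^sup>2)) / 2) has_real_derivative
                 1 / sqrt (v\<^sup>2 + 1) - inverse ((v + 1) ^ 3)) (at v)"
      by (intro DERIV_diff arsinh_real_has_field_derivative)
    have "sqrt (v\<^sup>2 + 1) \<le> v + 1"
      using v by (intro real_le_lsqrt) (auto simp: power2_eq_square field_simps)
    also have "\<dots> \<le> (v + 1) ^ 3" using v by (intro self_le_power) auto
    finally show "0 \<le> 1 / sqrt (v\<^sup>2 + 1) - inverse ((v + 1) ^ 3)"
      using v le_imp_inverse_le[of "sqrt (v\<^sup>2 + 1)" "(v + 1) ^ 3"]
      by (simp add: inverse_eq_divide add_nonneg_pos)
  qed (use assms in auto)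
  then show ?thesis by simp
qed

lemma rate_0: "rate 0 = 0"
  by (simp add: rate_def)

lemma rate_minus [simp]: "rate (- v) = rate v"
  by (simp add: rate_def arsinh_minus_real)

lemma rate_abs [simp]: "rate \<bar>v\<bar> = rate v"
  by (cases "v \<ge> 0") auto

text \<open>Each bound integrates a bound on \<open>arsinh\<close>, the derivative of
  \<open>rate\<close>. The first two pin down the behaviour at small v; the third has the correct
  order at 0 and still grows linearly at infinity.\<close>

lemma rate_bounds_nonneg:
  assumes "v \<ge> 0"
  shows "rate v \<le> v\<^sup>2 / 2" "rate v \<ge> v\<^sup>2 / 2 - v ^ 4 / 24" "rate v \<ge> v\<^sup>2 / (2 * (1 + v))"
proof -
  have "v\<^sup>2 / 2 - rate v \<ge> 0"
    by (rule nonneg_of_deriv_nonneg[where f="\<lambda>v. v\<^sup>2 / 2 - rate v" and f'="\<lambda>v. v - arsinh v"])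
       (use assms in \<open>auto intro!: derivative_eq_intros DERIV_rate arsinh_le simp: rate_0\<close>)
  then show "rate v \<le> v\<^sup>2 / 2" by simp
  have "rate v - (v\<^sup>2 / 2 - v ^ 4 / 24) \<ge> 0"
    by (rule nonneg_of_deriv_nonneg[where f="\<lambda>v. rate v - (v\<^sup>2 / 2 - v ^ 4 / 24)" and f'="\<lambda>v. arsinh v - (v - v ^ 3 / 6)"])
       (use assms arsinh_ge in \<open>auto intro!: derivative_eq_intros DERIV_rate simp: rate_0\<close>)
  then show "rate v \<ge> v\<^sup>2 / 2 - v ^ 4 / 24" by simp
  have "rate v - (v - 1 + inverse (v + 1)) / 2 \<ge> 0"
  proof (rule nonneg_of_deriv_nonneg[where f="\<lambda>v. rate v - (v - 1 + inverse (v + 1)) / 2"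
        and f'="\<lambda>v. arsinh v - (1 - inverse ((v + 1)\<^sup>2)) / 2"])
    fix v :: real assume v: "v \<ge> 0"
    show "((\<lambda>v. rate v - (v - 1 + inverse (v + 1)) / 2) has_real_derivative
             arsinh v - (1 - inverse ((v + 1)\<^sup>2)) / 2) (at v)"
      using v by (auto intro!: derivative_eq_intros DERIV_rate simp: power2_eq_square)
    show "0 \<le> arsinh v - (1 - inverse ((v + 1)\<^sup>2)) / 2" using arsinh_ge_rational[OF v] by simp
  qed (use assms in \<open>auto simp: rate_0\<close>)
  \<comment> \<open>The partial fraction form is the one that was differentiated above.\<close>
  moreover have "v\<^sup>2 / (2 * (1 + v)) = (v - 1 + inverse (v + 1)) / 2"
    using assms by (simp add: field_simps power2_eq_square)
  ultimately show "rate v \<ge> v\<^sup>2 / (2 * (1 + v))" by linarith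
qed

lemma rate_bounds:
  shows rate_le: "rate v \<le> v\<^sup>2 / 2"
    and rate_ge: "rate v \<ge> v\<^sup>2 / 2 - v ^ 4 / 24"
    and rate_ge_rational: "rate v \<ge> v\<^sup>2 / (2 * (1 + \<bar>v\<bar>))"
  using rate_bounds_nonneg[of "\<bar>v\<bar>"] by auto

section \<open>Contour shift to the saddle point\<close>

text \<open>With an entire primitive F, the integral at height v is F(pi + iv) - F(-pi + iv). Its
  derivative in v is i (f(pi + iv) - f(-pi + iv)), which vanishes by periodicity, so the height does
  not matter.\<close>

lemma integral_periodic_shift:
  fixes f :: "complex \<Rightarrow> complex"
  assumes hol: "f holomorphic_on UNIV" and per: "\<And>z. f (z + of_real (2 * pi)) = f z"
  shows "(LINT \<theta>:{-pi..pi}|lborel. f (of_real \<theta> + \<i> * of_real u)) = (LINT \<theta>:{-pi..pi}|lborel. f (of_real \<theta>))"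
proof -
  obtain F where F: "\<And>z. (F has_field_derivative f z) (at z)"
    using holomorphic_convex_primitive'[OF convex_UNIV open_UNIV hol] by auto
  have cf: "continuous_on UNIV f" using hol by (rule holomorphic_on_imp_continuous_on)
  have FTC: "(LINT \<theta>:{-pi..pi}|lborel. f (of_real \<theta> + \<i> * of_real v)) = F (of_real pi + \<i> * of_real v) - F (of_real (-pi) + \<i> * of_real v)" for v
    unfolding set_lebesgue_integral_def
  proof (rule integral_FTC_Icc)
    fix x :: real
    have "((\<lambda>x. F (of_real x + \<i> * of_real v)) has_vector_derivative 1 * f (of_real x + \<i> * of_real v)) (at x within {-pi..pi})"
      by (rule field_vector_diff_chain_within[where f="\<lambda>x. of_real x + \<i> * of_real v" and g=F, unfolded o_def])
         (auto intro!: derivative_eq_intros has_field_derivative_at_within[OF F])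
    then show "((\<lambda>x. F (of_real x + \<i> * of_real v)) has_vector_derivative f (of_real x + \<i> * of_real v)) (at x within {-pi..pi})"
      by simp
    show "continuous_on {-pi..pi} (\<lambda>x. f (of_real x + \<i> * of_real v))"
      by (intro continuous_on_compose2[OF cf] continuous_intros) auto
  qed auto
  let ?J = "\<lambda>v::real. F (of_real pi + \<i> * of_real v) - F (of_real (-pi) + \<i> * of_real v)"
  have "(?J has_vector_derivative 0) (at v within UNIV)" for v
  proof -
    have *: "((\<lambda>v. F (c + \<i> * of_real v)) has_vector_derivative \<i> * f (c + \<i> * of_real v)) (at v)" for c v
      by (rule field_vector_diff_chain_within[where f="\<lambda>v. c + \<i> * of_real v" and g=F and S=UNIV, unfolded o_def])
         (auto intro!: derivative_eq_intros has_field_derivative_at_within[OF F])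
    have "f (of_real pi + \<i> * of_real v) = f (of_real (-pi) + \<i> * of_real v)"
      using per[of "of_real (-pi) + \<i> * of_real v"] by (simp add: algebra_simps)
    then show ?thesis using has_vector_derivative_diff[OF *[of "of_real pi" v] *[of "of_real (-pi)" v]] by simp
  qed
  then obtain c where "\<And>v. v \<in> UNIV \<Longrightarrow> ?J v = c"
    using has_vector_derivative_zero_constant[OF convex_UNIV, of ?J] by blast
  then have "?J u = ?J 0" by (metis UNIV_I)
  then show ?thesis using FTC[of u] FTC[of 0] by simp
qed

text \<open>The integration line is moved to height \<open>arsinh (m / s)\<close>, where the saddle point lies.\<close>

lemma fourier_exp_cos_eq_tilted:
  assumes "s > 0"
  shows "fourier_exp_cos m s = of_real (2 * pi * exp (- s * rate (of_int m / s))) * tilted (of_int m) s"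
proof -
  define M where "M = real_of_int m"
  define u where "u = arsinh (M / s)"
  define f where "f = (\<lambda>z. exp (\<i> * of_real M * z - of_real s * (1 - cos z)))"
  have hol: "f holomorphic_on UNIV" unfolding f_def by (intro holomorphic_intros)
  have per: "f (z + of_real (2 * pi)) = f z" for z
  proof -
    have "cos (z + of_real (2 * pi)) = cos z"
      using cos_of_real[of "2 * pi"] sin_of_real[of "2 * pi"] by (simp add: cos_add)
    \<comment> \<open>Periodicity of the integrand rests on m being an integer.\<close>
    moreover have "exp (\<i> * of_real M * of_real (2 * pi)) = 1"
      using exp_integer_2pi[of "of_int m"] by (simp add: M_def mult_ac)
    ultimately show ?thesis
      unfolding f_def by (simp add: exp_diff exp_add ring_distribs)
  qed
  have sq: "sqrt (1 + (M/s)\<^sup>2) = sqrt (s\<^sup>2 + M\<^sup>2) / s"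
  proof -
    have "1 + (M/s)\<^sup>2 = (s\<^sup>2 + M\<^sup>2) / s\<^sup>2" using assms by (simp add: field_simps)
    then show ?thesis using assms by (simp only: real_sqrt_divide real_sqrt_abs abs_of_pos)
  qed
  \<comment> \<open>With sinh u = M/s the imaginary part M \<theta> - s sinh u sin \<theta> becomes
    M (\<theta> - sin \<theta>), of third order at 0, and s cosh u is
    \<open>sqrt (s\<^sup>2 + M\<^sup>2)\<close>. The terms independent of \<theta> collect to
    exactly -s rate(M/s).\<close>
  have shift: "f (of_real \<theta> + \<i> * of_real u) = of_real (exp (- s * rate (M / s))) *
     exp (\<i> * of_real (M * (\<theta> - sin \<theta>)) - of_real (sqrt (s\<^sup>2 + M\<^sup>2) * (1 - cos \<theta>)))" for \<theta>
  proof -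
    have "cos (of_real \<theta> + \<i> * of_real u) =
        of_real (cos \<theta>) * cosh (of_real u) - \<i> * (of_real (sin \<theta>) * sinh (of_real u))"
    proof -
      have "sin (\<i> * complex_of_real u) = \<i> * sinh (of_real u)" by (simp add: sinh_conv_sin)
      then show ?thesis
        by (simp add: cos_add cos_of_real sin_of_real cosh_conv_cos mult.assoc mult.left_commute)
    qed
    moreover have "cosh (complex_of_real u) = of_real (cosh u)" "sinh (complex_of_real u) = of_real (sinh u)"
      by (simp_all add: cosh_field_def sinh_field_def flip: exp_of_real)
    moreover have "sinh u = M / s" by (simp add: u_def)
    moreover have "cosh u = sqrt (s\<^sup>2 + M\<^sup>2) / s" using sq by (simp only: u_def cosh_arsinh_real add.commute)
    moreover have "s * rate (M / s) = M * u - sqrt (s\<^sup>2 + M\<^sup>2) + s"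
      unfolding rate_def sq using assms by (simp add: u_def ring_distribs)
    ultimately show ?thesis
      using assms unfolding f_def exp_of_real[symmetric] exp_add[symmetric]
      by (intro arg_cong[where f=exp]) (simp add: algebra_simps complex_eq_iff)
  qed
  have "fourier_exp_cos m s = (LINT \<theta>:{-pi..pi}|lborel. f (of_real \<theta>))"
    by (simp add: fourier_exp_cos_def f_def M_def mult_ac cos_of_real)
  also have "\<dots> = (LINT \<theta>:{-pi..pi}|lborel. f (of_real \<theta> + \<i> * of_real u))"
    by (rule integral_periodic_shift[OF hol per, symmetric])
  finally show ?thesis
    unfolding shift tilted_def by (simp add: M_def)
qed

section \<open>Gaussian bounds and limit for the shifted integral\<close>

lemma norm_integral_le:
  fixes f :: "'a \<Rightarrow> 'b::{banach, second_countable_topology}"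
  assumes g: "integrable M g" and f: "f \<in> borel_measurable M" and le: "\<And>x. norm (f x) \<le> g x"
  shows "norm (LINT x|M. f x) \<le> (LINT x|M. g x)"
proof -
  have "integrable M f"
    using le by (intro Bochner_Integration.integrable_bound[OF g f]) (auto intro: order_trans[OF _ abs_ge_self])
  then have "(LINT x|M. norm (f x)) \<le> (LINT x|M. g x)"
    using le by (intro integral_mono integrable_norm g)
  then show ?thesis using integral_norm_bound[of M f] by linarith
qed

lemma cos_ge: "cos x \<ge> 1 - x\<^sup>2 / (2::real)"
proof -
  have *: "cos x - (1 - x\<^sup>2 / 2) \<ge> 0" if "x \<ge> 0" for x :: real
    by (rule nonneg_of_deriv_nonneg[where f="\<lambda>x. cos x - (1 - x\<^sup>2 / 2)" and f'="\<lambda>x. x - sin x"])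
       (use that in \<open>auto intro!: derivative_eq_intros sin_x_le_x\<close>)
  from *[of "\<bar>x\<bar>"] show ?thesis by simp
qed

lemma sin_ge_cubic:
  assumes "x \<ge> 0" shows "sin x \<ge> x - x ^ 3 / (6::real)"
proof -
  have "sin x - (x - x ^ 3 / 6) \<ge> 0"
    by (rule nonneg_of_deriv_nonneg[where f="\<lambda>x. sin x - (x - x ^ 3 / 6)" and f'="\<lambda>x. cos x - (1 - x\<^sup>2 / 2)"])
       (use assms cos_ge in \<open>auto intro!: derivative_eq_intros\<close>)
  then show ?thesis by simp
qed

lemma abs_minus_sin_le: "\<bar>x - sin x\<bar> \<le> \<bar>x\<bar> ^ 3 / (6::real)"
proof (cases "x \<ge> 0")
  case True then show ?thesis using sin_ge_cubic[of x] sin_x_le_x[of x] by simp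
next
  case False then show ?thesis using sin_ge_cubic[of "-x"] sin_x_le_x[of "-x"] by simp
qed

lemma cos_le_quartic: "cos x \<le> 1 - x\<^sup>2 / 2 + x ^ 4 / (24::real)"
proof -
  have *: "(1 - x\<^sup>2 / 2 + x ^ 4 / 24) - cos x \<ge> 0" if "x \<ge> 0" for x :: real
  proof (rule nonneg_of_deriv_nonneg[where f="\<lambda>x. (1 - x\<^sup>2 / 2 + x ^ 4 / 24) - cos x" and f'="\<lambda>x. sin x - (x - x ^ 3 / 6)"])
  qed (use that sin_ge_cubic in \<open>auto intro!: derivative_eq_intros\<close>)
  from *[of "\<bar>x\<bar>"] show ?thesis by simp
qed

text \<open>On this range x^2 \<le> 10, so the quartic term of \<open>cos_le_quartic\<close> is at
  most 10 x^2 / 24, which leaves (12 - 10) x^2 / 24.\<close>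

lemma one_minus_cos_ge:
  assumes "\<bar>x\<bar> \<le> pi"
  shows "1 - cos x \<ge> x\<^sup>2 / 12"
proof -
  have "\<bar>x\<bar> \<le> 3.1416" using assms pi_approx by simp
  then have "\<bar>x\<bar>\<^sup>2 \<le> 3.1416\<^sup>2" by (intro power_mono) auto
  then have "x\<^sup>2 \<le> 10" by (simp add: power2_eq_square)
  then have "x\<^sup>2 * x\<^sup>2 \<le> 10 * x\<^sup>2" by (intro mult_right_mono) auto
  moreover have "x ^ 4 = x\<^sup>2 * x\<^sup>2" by (simp flip: power_add)
  ultimately show ?thesis using cos_le_quartic[of x] by linarith
qed

lemma integrable_exp_neg_square:
  fixes c :: real
  assumes "c > 0" shows "integrable lborel (\<lambda>w. exp (- (c * w\<^sup>2)))"
proof -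
  have "integrable lborel (\<lambda>w. (sqrt (2 * pi * (1 / (2 * c)))) * normal_density 0 (sqrt (1 / (2 * c))) w)"
    using assms by (intro integrable_mult_right integrable_normal_density) auto
  moreover have "(sqrt (2 * pi * (1 / (2 * c)))) * normal_density 0 (sqrt (1 / (2 * c))) w = exp (- (c * w\<^sup>2))" for w
    using assms by (simp add: normal_density_def)
  ultimately show ?thesis by (simp only:)
qed

lemma integral_exp_neg_half_square: "(LINT w|lborel. exp (- (w\<^sup>2 / 2))) = sqrt (2 * pi)"
proof -
  have "(LINT w|lborel. exp (- (w\<^sup>2 / 2))) = (LINT w|lborel. sqrt (2 * pi) * std_normal_density w)"
    by (intro Bochner_Integration.integral_cong) (auto simp: std_normal_density_def)
  also have "\<dots> = sqrt (2 * pi)" by simp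
  finally show ?thesis .
qed

text \<open>The integrand of \<open>tilted\<close> after \<theta> = w / sqrt s, extended by zero so
  that all s share one domain of integration, as dominated convergence requires.\<close>

definition tilted_integrand :: "real \<Rightarrow> real \<Rightarrow> real \<Rightarrow> complex" where
  "tilted_integrand m s w = indicator {-(pi * sqrt s)..pi * sqrt s} w *\<^sub>R
     exp (\<i> * of_real (m * (w / sqrt s - sin (w / sqrt s))) - of_real (sqrt (s\<^sup>2 + m\<^sup>2) * (1 - cos (w / sqrt s))))"

lemma borel_measurable_tilted [measurable]: "(\<lambda>s. tilted m (h s)) \<in> borel_measurable M" if [measurable]: "h \<in> borel_measurable M"
  unfolding tilted_def set_lebesgue_integral_def by measurable

lemma tilted_integrand_measurable [measurable]: "tilted_integrand m s \<in> borel_measurable borel"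
  unfolding tilted_integrand_def[abs_def] by measurable

lemma sqrt_times_tilted:
  assumes "s > 0"
  shows "of_real (sqrt s) * tilted m s = (LINT w|lborel. tilted_integrand m s w) / of_real (2 * pi)"
proof -
  define F where "F \<theta> = indicator {-pi..pi} \<theta> *\<^sub>R
     exp (\<i> * of_real (m * (\<theta> - sin \<theta>)) - of_real (sqrt (s\<^sup>2 + m\<^sup>2) * (1 - cos \<theta>)))" for \<theta>
  have "tilted m s = (LINT \<theta>|lborel. F \<theta>) / of_real (2 * pi)"
    by (simp add: tilted_def set_lebesgue_integral_def F_def)
  also have "(LINT \<theta>|lborel. F \<theta>) = \<bar>1 / sqrt s\<bar> *\<^sub>R (LINT w|lborel. F (0 + 1 / sqrt s * w))"
    using assms by (intro lborel_integral_real_affine) auto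
  also have "(\<lambda>w. F (0 + 1 / sqrt s * w)) = tilted_integrand m s"
    using assms by (auto simp: F_def tilted_integrand_def fun_eq_iff indicator_def field_simps)
  finally show ?thesis using assms by (simp add: scaleR_conv_of_real field_simps)
qed

text \<open>The phase has modulus 1, and \<open>sqrt (s\<^sup>2 + m\<^sup>2)\<close> is at least s,
  so the Gaussian bound is the same for every m.\<close>

lemma norm_tilted_integrand_le:
  assumes "s > 0"
  shows "norm (tilted_integrand m s w) \<le> exp (- (1 / 12 * w\<^sup>2))"
proof (cases "\<bar>w\<bar> \<le> pi * sqrt s")
  case True
  then have "\<bar>w / sqrt s\<bar> \<le> pi" using assms by (simp add: abs_divide divide_le_eq)
  then have "1 - cos (w / sqrt s) \<ge> w\<^sup>2 / s / 12"
    using one_minus_cos_ge[of "w / sqrt s"] assms by (simp add: power_divide)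
  moreover have "s \<le> sqrt (s\<^sup>2 + m\<^sup>2)" by (rule real_le_rsqrt) auto
  ultimately have "s * (w\<^sup>2 / s / 12) \<le> sqrt (s\<^sup>2 + m\<^sup>2) * (1 - cos (w / sqrt s))"
    using assms by (intro mult_mono) auto
  then show ?thesis using assms
    by (simp add: tilted_integrand_def norm_exp_eq_Re split: split_indicator)
next
  case False
  then have "tilted_integrand m s w = 0" by (auto simp: tilted_integrand_def indicator_def)
  then show ?thesis by simp
qed

lemma tilted_bound:
  obtains K where "K \<ge> 1" "\<And>m s. s > 0 \<Longrightarrow> norm (tilted m s) \<le> K / sqrt s"
proof
  define K :: real where "K = (LINT w|lborel. exp (- (1 / 12 * w\<^sup>2)))"
  \<comment> \<open>Keeping the constant at least 1 lets it serve for the trivial bound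
    \<open>norm_tilted_le_one\<close> as well, in \<open>Laplace_factor_bound\<close>.\<close>
  show "max 1 K \<ge> 1" by simp
  fix m s :: real assume s: "s > 0"
  have "norm (of_real (sqrt s) * tilted m s) \<le> K / (2 * pi)"
    unfolding sqrt_times_tilted[OF s] K_def
    using norm_integral_le[OF integrable_exp_neg_square[of "1/12"] _ norm_tilted_integrand_le[OF s, of m]]
    by (simp add: norm_divide divide_right_mono)
  also have "K / (2 * pi) \<le> K / 1"
    unfolding K_def using pi_gt3 by (intro divide_left_mono) auto
  also have "\<dots> \<le> max 1 K" by simp
  finally show "norm (tilted m s) \<le> max 1 K / sqrt s"
    using s by (simp add: norm_mult field_simps)
qed

lemma norm_tilted_le_one: "norm (tilted m s) \<le> 1"
proof -
  let ?F = "\<lambda>\<theta>. indicator {-pi..pi} \<theta> *\<^sub>R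
     exp (\<i> * of_real (m * (\<theta> - sin \<theta>)) - of_real (sqrt (s\<^sup>2 + m\<^sup>2) * (1 - cos \<theta>)))"
  have int: "integrable lborel (\<lambda>\<theta>. indicator {-pi..pi} \<theta> :: real)"
    by (intro integrable_real_indicator) auto
  have le: "norm (?F \<theta>) \<le> indicator {-pi..pi} \<theta>" for \<theta>
    by (auto simp: norm_exp_eq_Re intro!: mult_nonneg_nonneg split: split_indicator)
  have "norm (LINT \<theta>|lborel. ?F \<theta>) \<le> (LINT \<theta>|lborel. indicator {-pi..pi} \<theta>)"
    by (intro norm_integral_le int le) measurable
  also have "\<dots> = 2 * pi" by simp
  finally show ?thesis
    by (simp add: tilted_def set_lebesgue_integral_def norm_divide)
qed

text \<open>The phase is at most |m/s| |w|^3 / (6 sqrt s), by the cubic bound on x - sin x, and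
  disappears. In the damping term the square root is s sqrt(1 + (m/s)^2), so m/s \<rightarrow> 0
  reduces it to s (1 - cos(w / sqrt s)), squeezed to w^2/2.\<close>

lemma tilted_integrand_tendsto:
  fixes m s :: "nat \<Rightarrow> real"
  assumes s: "filterlim s at_top sequentially" and ms: "(\<lambda>n. m n / s n) \<longlonglongrightarrow> 0"
  shows "(\<lambda>n. tilted_integrand (m n) (s n) w) \<longlonglongrightarrow> of_real (exp (- (w\<^sup>2 / 2)))"
proof -
  have pos: "eventually (\<lambda>n. s n > 0) sequentially" using s by (simp add: filterlim_at_top_dense)
  have inv: "(\<lambda>n. inverse (s n)) \<longlonglongrightarrow> 0" by (rule tendsto_inverse_0_at_top[OF s])
  have isq: "(\<lambda>n. inverse (sqrt (s n))) \<longlonglongrightarrow> 0"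
    by (rule tendsto_inverse_0_at_top, rule filterlim_compose[OF sqrt_at_top s])
  have A: "(\<lambda>n. m n * (w / sqrt (s n) - sin (w / sqrt (s n)))) \<longlonglongrightarrow> 0"
  proof (rule tendsto_rabs_zero_cancel, rule tendsto_sandwich[of "\<lambda>_. 0"])
    show "(\<lambda>n. \<bar>m n / s n\<bar> * (\<bar>w\<bar> ^ 3 / 6) * inverse (sqrt (s n))) \<longlonglongrightarrow> 0"
      using tendsto_mult[OF tendsto_mult[OF tendsto_rabs_zero[OF ms] tendsto_const[of "\<bar>w\<bar> ^ 3 / 6"]] isq] by simp
    show "eventually (\<lambda>n. \<bar>m n * (w / sqrt (s n) - sin (w / sqrt (s n)))\<bar> \<le>
        \<bar>m n / s n\<bar> * (\<bar>w\<bar> ^ 3 / 6) * inverse (sqrt (s n))) sequentially"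
      using pos
    proof eventually_elim
      case (elim n)
      have "\<bar>m n * (w / sqrt (s n) - sin (w / sqrt (s n)))\<bar> \<le> \<bar>m n\<bar> * (\<bar>w / sqrt (s n)\<bar> ^ 3 / 6)"
        unfolding abs_mult by (intro mult_left_mono abs_minus_sin_le) auto
      also have "\<bar>w / sqrt (s n)\<bar> ^ 3 = \<bar>w\<bar> ^ 3 / (s n * sqrt (s n))"
        using elim by (simp add: power_divide power3_eq_cube)
      finally show ?case using elim by (simp add: field_simps)
    qed
  qed auto
  have B: "(\<lambda>n. s n * (1 - cos (w / sqrt (s n)))) \<longlonglongrightarrow> w\<^sup>2 / 2"
  proof (rule tendsto_sandwich)
    show "(\<lambda>n. w\<^sup>2 / 2 - w ^ 4 / 24 * inverse (s n)) \<longlonglongrightarrow> w\<^sup>2 / 2"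
      using tendsto_diff[OF tendsto_const[of "w\<^sup>2 / 2"] tendsto_mult[OF tendsto_const[of "w ^ 4 / 24"] inv]] by simp
    show "eventually (\<lambda>n. w\<^sup>2 / 2 - w ^ 4 / 24 * inverse (s n) \<le> s n * (1 - cos (w / sqrt (s n)))) sequentially"
      using pos
    proof eventually_elim
      case (elim n)
      have p4: "sqrt (s n) ^ 4 = s n * s n"
        using elim by (simp add: power4_eq_xxxx)
      have "s n * ((w / sqrt (s n))\<^sup>2 / 2 - (w / sqrt (s n)) ^ 4 / 24) \<le> s n * (1 - cos (w / sqrt (s n)))"
        using cos_le_quartic[of "w / sqrt (s n)"] elim by (intro mult_left_mono) auto
      moreover have "s n * ((w / sqrt (s n))\<^sup>2 / 2 - (w / sqrt (s n)) ^ 4 / 24) = w\<^sup>2 / 2 - w ^ 4 / 24 * inverse (s n)"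
        using elim by (simp add: power_divide p4 field_simps)
      ultimately show ?case by simp
    qed
    show "eventually (\<lambda>n. s n * (1 - cos (w / sqrt (s n))) \<le> w\<^sup>2 / 2) sequentially"
      using pos
    proof eventually_elim
      case (elim n)
      have "s n * (1 - cos (w / sqrt (s n))) \<le> s n * ((w / sqrt (s n))\<^sup>2 / 2)"
        using cos_ge[of "w / sqrt (s n)"] elim by (intro mult_left_mono) auto
      then show ?case using elim by (simp add: power_divide)
    qed
  qed auto
  have "(\<lambda>n. sqrt (1 + (m n / s n)\<^sup>2)) \<longlonglongrightarrow> sqrt (1 + 0\<^sup>2)"
    by (intro tendsto_intros ms)
  from tendsto_mult[OF this B]
  have "(\<lambda>n. sqrt (1 + (m n / s n)\<^sup>2) * (s n * (1 - cos (w / sqrt (s n))))) \<longlonglongrightarrow> w\<^sup>2 / 2" by simp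
  then have C: "(\<lambda>n. sqrt ((s n)\<^sup>2 + (m n)\<^sup>2) * (1 - cos (w / sqrt (s n)))) \<longlonglongrightarrow> w\<^sup>2 / 2"
  proof (rule Lim_transform_eventually)
    show "eventually (\<lambda>n. sqrt (1 + (m n / s n)\<^sup>2) * (s n * (1 - cos (w / sqrt (s n)))) =
      sqrt ((s n)\<^sup>2 + (m n)\<^sup>2) * (1 - cos (w / sqrt (s n)))) sequentially"
      using pos
    proof eventually_elim
      case (elim n)
      have "(s n)\<^sup>2 + (m n)\<^sup>2 = (1 + (m n / s n)\<^sup>2) * (s n)\<^sup>2" using elim by (simp add: field_simps)
      then have "sqrt ((s n)\<^sup>2 + (m n)\<^sup>2) = sqrt (1 + (m n / s n)\<^sup>2) * s n"
        using elim by (simp add: real_sqrt_mult)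
      then show ?case by simp
    qed
  qed
  have "(\<lambda>n. exp (\<i> * of_real (m n * (w / sqrt (s n) - sin (w / sqrt (s n)))) -
      of_real (sqrt ((s n)\<^sup>2 + (m n)\<^sup>2) * (1 - cos (w / sqrt (s n)))))) \<longlonglongrightarrow> exp (\<i> * of_real 0 - of_real (w\<^sup>2 / 2))"
    by (intro tendsto_intros A C)
  then have D: "(\<lambda>n. exp (\<i> * of_real (m n * (w / sqrt (s n) - sin (w / sqrt (s n)))) -
      of_real (sqrt ((s n)\<^sup>2 + (m n)\<^sup>2) * (1 - cos (w / sqrt (s n)))))) \<longlonglongrightarrow> of_real (exp (- (w\<^sup>2 / 2)))"
    by (simp flip: exp_of_real)
  have "filterlim (\<lambda>n. pi * sqrt (s n)) at_top sequentially"
    by (rule filterlim_tendsto_pos_mult_at_top[OF tendsto_const pi_gt_zero filterlim_compose[OF sqrt_at_top s]])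
  then have "eventually (\<lambda>n. pi * sqrt (s n) \<ge> \<bar>w\<bar>) sequentially"
    by (simp add: filterlim_at_top)
  then have "eventually (\<lambda>n. exp (\<i> * of_real (m n * (w / sqrt (s n) - sin (w / sqrt (s n)))) -
      of_real (sqrt ((s n)\<^sup>2 + (m n)\<^sup>2) * (1 - cos (w / sqrt (s n))))) = tilted_integrand (m n) (s n) w) sequentially"
    by eventually_elim (auto simp: tilted_integrand_def indicator_def)
  from Lim_transform_eventually[OF D this] show ?thesis .
qed

lemma tilted_tendsto:
  fixes m s :: "nat \<Rightarrow> real"
  assumes s: "filterlim s at_top sequentially" and ms: "(\<lambda>n. m n / s n) \<longlonglongrightarrow> 0"
  shows "(\<lambda>n. of_real (sqrt (2 * pi * s n)) * tilted (m n) (s n)) \<longlonglongrightarrow> 1"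
proof -
  have "eventually (\<lambda>n. s n > 0) sequentially" using s by (simp add: filterlim_at_top_dense)
  \<comment> \<open>The domination holds only where s is positive, and dominated convergence asks
    for it at every index; hence the shift by N, undone at the end by
    \<open>LIMSEQ_offset\<close>.\<close>
  then obtain N where N: "\<And>n. n \<ge> N \<Longrightarrow> s n > 0" by (auto simp: eventually_sequentially)
  have "(\<lambda>n. LINT w|lborel. tilted_integrand (m (n + N)) (s (n + N)) w) \<longlonglongrightarrow>
     (LINT w|lborel. complex_of_real (exp (- (w\<^sup>2 / 2))))"
    by (rule integral_dominated_convergence[where w="\<lambda>w. exp (- (1 / 12 * w\<^sup>2))"])
       (use tilted_integrand_tendsto[OF s ms] N norm_tilted_integrand_le integrable_exp_neg_square[of "1/12"]
         in \<open>auto intro!: LIMSEQ_ignore_initial_segment\<close>)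
  then have "(\<lambda>n. LINT w|lborel. tilted_integrand (m (n + N)) (s (n + N)) w) \<longlonglongrightarrow> of_real (sqrt (2 * pi))"
    unfolding integral_complex_of_real integral_exp_neg_half_square .
  from tendsto_mult[OF tendsto_const[of "of_real (sqrt (2 * pi) / (2 * pi))"] this]
  have "(\<lambda>n. of_real (sqrt (2 * pi)) * ((LINT w|lborel. tilted_integrand (m (n + N)) (s (n + N)) w) / of_real (2 * pi)))
     \<longlonglongrightarrow> of_real (sqrt (2 * pi) / (2 * pi) * sqrt (2 * pi))"
    by (simp only: of_real_mult of_real_divide times_divide_eq_left times_divide_eq_right)
  moreover have "sqrt (2 * pi) / (2 * pi) * sqrt (2 * pi) = 1" by simp
  moreover have eq: "of_real (sqrt (s (n + N))) * tilted (m (n + N)) (s (n + N)) =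
      (LINT w|lborel. tilted_integrand (m (n + N)) (s (n + N)) w) / of_real (2 * pi)" for n
    by (rule sqrt_times_tilted[OF N]) simp
  ultimately have "(\<lambda>n. of_real (sqrt (2 * pi)) * (of_real (sqrt (s (n + N))) * tilted (m (n + N)) (s (n + N))))
      \<longlonglongrightarrow> of_real 1"
    by (simp only: eq)
  then have "(\<lambda>n. of_real (sqrt (2 * pi * s (n + N))) * tilted (m (n + N)) (s (n + N))) \<longlonglongrightarrow> 1"
    unfolding real_sqrt_mult[of "2 * pi"] of_real_mult[of "sqrt (2 * pi)"] by (simp only: mult.assoc of_real_1)
  then show ?thesis by (rule LIMSEQ_offset)
qed

section \<open>The Green function as a one-dimensional integral\<close>

text \<open>\<open>lborel_eq\<close> presents the measure as the image of a product indexed by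
  \<open>Basis\<close>. The bijection \<open>ax\<close> from coordinates to basis vectors carries
  the product over \<open>'d\<close> there and back.\<close>

lemma lborel_integral_prod_vec:
  fixes f :: "'d::finite \<Rightarrow> real \<Rightarrow> complex"
  assumes f: "\<And>j. integrable lborel (f j)"
  shows "(LINT k|(lborel :: (real ^ 'd) measure). (\<Prod>j\<in>UNIV. f j (k $ j))) = (\<Prod>j\<in>UNIV. LINT \<theta>|lborel. f j \<theta>)"
proof -
  interpret product_sigma_finite "\<lambda>_::real ^ 'd. lborel :: real measure" ..
  have [measurable]: "f j \<in> borel_measurable borel" for j using f[of j] by simp
  define ax where "ax j = (axis j 1 :: real ^ 'd)" for j
  have inj: "inj ax" by (auto simp: ax_def inj_on_def axis_eq_axis)
  have Basis: "(Basis :: (real ^ 'd) set) = range ax" by (auto simp: Basis_vec_def ax_def)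
  have comp: "(\<Sum>b\<in>Basis. F b *\<^sub>R b) $ j = F (ax j)" for F :: "real ^ 'd \<Rightarrow> real" and j
  proof -
    have "(\<Sum>b\<in>Basis. F b *\<^sub>R b) $ j = (\<Sum>i\<in>UNIV. (F (ax i) *\<^sub>R ax i) $ j)"
      by (simp add: Basis sum.reindex[OF inj])
    also have "\<dots> = (\<Sum>i\<in>UNIV. if i = j then F (ax i) else 0)"
      by (intro sum.cong) (auto simp: ax_def axis_def)
    finally show ?thesis by simp
  qed
  have "(LINT k|(lborel :: (real ^ 'd) measure). (\<Prod>j\<in>UNIV. f j (k $ j))) =
      (LINT F|Pi\<^sub>M Basis (\<lambda>_. lborel). (\<Prod>j\<in>UNIV. f j ((\<Sum>b\<in>Basis. F b *\<^sub>R b :: real ^ 'd) $ j)))"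
    by (subst lborel_eq, subst integral_distr) measurable
  also have "\<dots> = (LINT F|Pi\<^sub>M Basis (\<lambda>_. lborel). (\<Prod>b\<in>Basis. f (inv ax b) (F b)))"
    unfolding comp by (simp add: Basis prod.reindex[OF inj] inv_f_f[OF inj])
  also have "\<dots> = (\<Prod>b\<in>Basis. LINT \<theta>|lborel. f (inv ax b) \<theta>)"
    by (rule product_integral_prod) (auto intro: f)
  also have "\<dots> = (\<Prod>j\<in>UNIV. LINT \<theta>|lborel. f j \<theta>)"
    by (simp add: Basis prod.reindex[OF inj] inv_f_f[OF inj])
  finally show ?thesis .
qed

lemma has_bochner_integral_Gamma:
  fixes q A :: real
  assumes q: "q > 0" and A: "A > 0"
  shows "has_bochner_integral lborel (\<lambda>t. indicator {0<..} t * (t powr (q - 1) * exp (- (A * t)))) (Gamma q / A powr q)"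
proof -
  have "(\<integral>\<^sup>+t. ennreal (indicator {0..} t * t powr (q - 1) / exp t) \<partial>lborel) = ennreal (Gamma q)"
    using Gamma_conv_nn_integral_real[OF q] by simp
  then have "has_bochner_integral lborel (\<lambda>t. indicator {0..} t * t powr (q - 1) / exp t) (Gamma q)"
    using q by (intro has_bochner_integral_nn_integral) (auto intro: less_imp_le Gamma_real_pos)
  then have "has_bochner_integral lborel (\<lambda>t. indicator {0..} (A * t) * (A * t) powr (q - 1) / exp (A * t)) (Gamma q / A)"
    using lborel_has_bochner_integral_real_affine_iff[of A "\<lambda>t. indicator {0..} t * t powr (q - 1) / exp t" "Gamma q" 0] A
    by (simp add: divide_inverse mult.commute)
  then have "has_bochner_integral lborel (\<lambda>t. A powr (1 - q) * (indicator {0..} (A * t) * (A * t) powr (q - 1) / exp (A * t)))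
      (A powr (1 - q) * (Gamma q / A))"
    by (rule has_bochner_integral_mult_right)
  moreover have "A powr (1 - q) * (indicator {0..} (A * t) * (A * t) powr (q - 1) / exp (A * t)) =
     indicator {0<..} t * (t powr (q - 1) * exp (- (A * t)))" for t
  proof (cases "t > 0")
    case True
    then have "A powr (1 - q) * (A * t) powr (q - 1) = t powr (q - 1)"
      using A by (simp add: powr_mult flip: mult.assoc powr_add)
    then show ?thesis using True A by (simp add: exp_minus divide_inverse flip: mult.assoc)
  next
    case False
    \<comment> \<open>At t = 0 the closed and the open half-line disagree, but
      \<open>0 powr (q - 1)\<close> is 0.\<close>
    then show ?thesis using A by (auto simp: indicator_def zero_le_mult_iff)
  qed
  moreover have "A powr (1 - q) * (Gamma q / A) = Gamma q / A powr q"
    using A by (simp add: powr_diff)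
  ultimately show ?thesis by simp
qed

lemma torus_box_eq: "torus_box = cbox (\<chi> i. - pi) (\<chi> i. pi)"
  by (auto simp: torus_box_def mem_box_cart)

lemma torus_box_sets [measurable]: "torus_box \<in> sets borel"
  unfolding torus_box_eq by simp

lemma D_hat_measurable [measurable]: "D_hat \<in> borel_measurable borel"
  unfolding D_hat_def[abs_def] by (intro borel_measurable_continuous_onI continuous_intros)

lemma D_hat_le_one: "D_hat (k :: real ^ 'd) \<le> 1"
proof -
  have "(\<Sum>j\<in>(UNIV :: 'd set). cos (k $ j)) \<le> (\<Sum>j\<in>(UNIV :: 'd set). 1)"
    by (intro sum_mono) simp
  then show ?thesis by (simp add: D_hat_def divide_le_eq)
qed

text \<open>The order of integration may be exchanged because 1 - \<open>D_hat\<close> is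
  nonnegative, so the resolvent denominator stays above a^2 > 0 on the bounded box. At fixed t the
  integrand in k is a product over coordinates, and the 1/d in \<open>D_hat\<close> turns t into t/d
  in each factor.\<close>

lemma lattice_green_eq_Laplace:
  fixes x :: "int ^ 'd"
  assumes q: "q > 0" and a: "a > 0"
  shows "lattice_green q a x =
    (LINT t|lborel. indicator {0<..} t *\<^sub>R (of_real (t powr (q - 1) * exp (- (a\<^sup>2 * t))) *
       (\<Prod>j\<in>UNIV. fourier_exp_cos (x $ j) (t / real CARD('d))))) / of_real ((2 * pi) ^ CARD('d) * Gamma q)"
proof -
  define A where "A k = a\<^sup>2 + 1 - D_hat k" for k :: "real ^ 'd"
  define ph where "ph k = exp (\<i> * of_real (k \<bullet> real_vec x))" for k :: "real ^ 'd"
  define f where "f k t = indicator torus_box k *\<^sub>R (indicator {0<..} t *\<^sub>R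
     (ph k * of_real (t powr (q - 1) * exp (- (A k * t)))))" for k and t :: real
  have [measurable]: "A \<in> borel_measurable borel" unfolding A_def[abs_def] by measurable
  have [measurable]: "ph \<in> borel_measurable borel"
    unfolding ph_def[abs_def] by (intro borel_measurable_continuous_onI continuous_intros)
  have Age: "A k \<ge> a\<^sup>2" for k using D_hat_le_one[of k] by (simp add: A_def)
  have A0: "A k > 0" for k using Age[of k] zero_less_power[OF a, of 2] by linarith
  have nph: "norm (ph k) = 1" for k by (simp add: ph_def)
  have nf: "norm (f k t) = indicator torus_box k * (indicator {0<..} t * (t powr (q - 1) * exp (- (A k * t))))" for k t
    by (simp add: f_def norm_mult nph)
  have hb: "has_bochner_integral lborel (\<lambda>t. indicator {0<..} t * (t powr (q - 1) * exp (- (A k * t)))) (Gamma q / A k powr q)" for k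
    by (rule has_bochner_integral_Gamma[OF q A0])
  have hbc: "has_bochner_integral lborel (f k) (indicator torus_box k *\<^sub>R (ph k * of_real (Gamma q / A k powr q)))" for k
  proof -
    have "has_bochner_integral lborel (\<lambda>t. complex_of_real (indicator {0<..} t * (t powr (q - 1) * exp (- (A k * t))))) (of_real (Gamma q / A k powr q))"
      by (rule has_bochner_integral_of_real[OF hb])
    from has_bochner_integral_scaleR_right[OF has_bochner_integral_mult_right[OF this, of "ph k"], of "indicator torus_box k"]
    show ?thesis
      by (rule has_bochner_integral_cong[THEN iffD1, rotated -1]) (auto simp: f_def scaleR_conv_of_real)
  qed
  have int_norm: "(LINT t|lborel. norm (f k t)) = indicator torus_box k * (Gamma q / A k powr q)" for k
    unfolding nf by (simp add: has_bochner_integral_integral_eq[OF hb])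
  have int: "integrable (lborel \<Otimes>\<^sub>M lborel) (case_prod f)"
  proof (rule lborel_pair.Fubini_integrable)
    show "case_prod f \<in> borel_measurable (lborel \<Otimes>\<^sub>M lborel)"
      unfolding f_def[abs_def] by measurable
    show "AE k in lborel. integrable lborel (\<lambda>t. case_prod f (k, t))"
      using hbc by (auto intro: integrable.intros)
    \<comment> \<open>Dominating function: \<open>A k\<close> is replaced by its lower bound a^2,
      leaving a constant on a bounded box.\<close>
    have "integrable lborel (\<lambda>k :: real ^ 'd. indicator torus_box k * (Gamma q / (a\<^sup>2) powr q))"
      unfolding torus_box_eq by (intro integrable_mult_left integrable_real_indicator) (auto intro: emeasure_bounded_finite[unfolded infinity_ennreal_def])
    then have "integrable lborel (\<lambda>k. indicator torus_box k * (Gamma q / A k powr q))"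
    proof (rule Bochner_Integration.integrable_bound)
      show "AE k in lborel. norm (indicator torus_box k * (Gamma q / A k powr q)) \<le>
         norm (indicator torus_box k * (Gamma q / (a\<^sup>2) powr q))"
      proof (intro always_eventually allI)
        fix k :: "real ^ 'd"
        have "(a\<^sup>2) powr q \<le> A k powr q" using q Age[of k] by (intro powr_mono2) auto
        then have "Gamma q / A k powr q \<le> Gamma q / (a\<^sup>2) powr q"
          using a A0[of k] Gamma_real_pos[OF q] by (intro divide_left_mono mult_pos_pos) auto
        then show "norm (indicator torus_box k * (Gamma q / A k powr q)) \<le>
           norm (indicator torus_box k * (Gamma q / (a\<^sup>2) powr q))"
          using Gamma_real_pos[OF q] by (auto simp: indicator_def)
      qed
    qed measurable
    then show "integrable lborel (\<lambda>k. LINT t|lborel. norm (case_prod f (k, t)))"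
      by (simp add: int_norm)
  qed
  have fub: "(LINT t|lborel. (LINT k|lborel. f k t)) = (LINT k|lborel. (LINT t|lborel. f k t))"
    by (rule lborel_pair.Fubini_integral[OF int])
  have "(LINT k|lborel. (LINT t|lborel. f k t)) = (LINT k|lborel. of_real (Gamma q) * (indicator torus_box k *\<^sub>R
      (ph k / of_real (A k powr q))))"
    by (intro Bochner_Integration.integral_cong refl)
       (simp add: has_bochner_integral_integral_eq[OF hbc] scaleR_conv_of_real)
  also have "\<dots> = of_real (Gamma q) * (lattice_green q a x * of_real ((2 * pi) ^ CARD('d)))"
    unfolding integral_mult_right_zero by (simp add: lattice_green_def set_lebesgue_integral_def ph_def A_def)
  finally have L: "(LINT k|lborel. (LINT t|lborel. f k t)) =
      of_real (Gamma q) * (lattice_green q a x * of_real ((2 * pi) ^ CARD('d)))" .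
  have R: "(LINT k|lborel. f k t) = indicator {0<..} t *\<^sub>R (of_real (t powr (q - 1) * exp (- (a\<^sup>2 * t))) *
       (\<Prod>j\<in>UNIV. fourier_exp_cos (x $ j) (t / real CARD('d))))" for t
  proof -
    define g where "g j \<theta> = indicator {-pi..pi} \<theta> *\<^sub>R
      exp (\<i> * of_real (of_int (x $ j) * \<theta>) - of_real (t / real CARD('d) * (1 - cos \<theta>)))" for j \<theta>
    have gint: "integrable lborel (g j)" for j
      unfolding g_def[abs_def] by (intro borel_integrable_compact continuous_intros) auto
    have ind: "indicator torus_box k = (\<Prod>j\<in>UNIV. indicator {-pi..pi} (k $ j) :: real)" for k :: "real ^ 'd"
      by (auto simp: torus_box_def indicator_def prod_zero_iff)
    have "f k t = (indicator {0<..} t *\<^sub>R of_real (t powr (q - 1) * exp (- (a\<^sup>2 * t)))) * (\<Prod>j\<in>UNIV. g j (k $ j))" for k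
    proof -
      have S: "(\<Sum>j\<in>UNIV. \<i> * of_real (of_int (x $ j) * (k $ j)) - of_real (t / real CARD('d) * (1 - cos (k $ j))))
         = \<i> * of_real (k \<bullet> real_vec x) - of_real (t * (1 - D_hat k))"
        by (simp add: sum_subtractf inner_vec_def real_vec_def D_hat_def sum_distrib_left mult_ac
             right_diff_distrib flip: sum_divide_distrib of_real_sum)
           (simp add: sum_distrib_left mult_ac)
      have "(\<Prod>j\<in>UNIV. g j (k $ j)) = indicator torus_box k *\<^sub>R exp (\<i> * of_real (k \<bullet> real_vec x) - of_real (t * (1 - D_hat k)))"
        unfolding g_def S[symmetric] ind by (simp add: exp_sum scaleR_conv_of_real prod.distrib)
      moreover have "of_real (exp (- (A k * t))) = of_real (exp (- (a\<^sup>2 * t))) * (exp (- of_real (t * (1 - D_hat k))) :: complex)"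
        unfolding exp_of_real[symmetric] exp_add[symmetric] by (simp add: A_def algebra_simps)
      ultimately show ?thesis
        by (simp add: f_def ph_def scaleR_conv_of_real exp_diff exp_minus divide_inverse mult_ac)
    qed
    then have "(LINT k|lborel. f k t) = (indicator {0<..} t *\<^sub>R of_real (t powr (q - 1) * exp (- (a\<^sup>2 * t)))) *
        (LINT k|lborel. (\<Prod>j\<in>UNIV. g j (k $ j)))" by simp
    also have "(LINT k|lborel. (\<Prod>j\<in>UNIV. g j ((k :: real ^ 'd) $ j))) = (\<Prod>j\<in>UNIV. LINT \<theta>|lborel. g j \<theta>)"
      by (rule lborel_integral_prod_vec[OF gint])
    finally show ?thesis
      by (simp add: g_def fourier_exp_cos_def set_lebesgue_integral_def)
  qed
  have "Gamma q \<noteq> 0" using Gamma_real_pos[OF q] by simp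
  then show ?thesis using fub unfolding L R by (simp add: field_simps)
qed

section \<open>The rescaled integral and Laplace's method\<close>

text \<open>
  Below \<open>b = sqrt (2 d) a\<close>, \<open>R\<close> is the Euclidean norm of the lattice point, \<open>e\<close> its direction,
  and \<open>t = (d R / b) \<tau>\<close>. The value \<open>b R\<close> of the exponent at its minimum is split off.
\<close>

definition Laplace_exponent :: "('d::finite \<Rightarrow> real) \<Rightarrow> real \<Rightarrow> real \<Rightarrow> real \<Rightarrow> real" where
  "Laplace_exponent e b R \<tau> = b * R * (\<tau> / 2 - 1) + (\<Sum>j\<in>UNIV. R * \<tau> / b * rate (b * e j / \<tau>))"

text \<open>\<open>sqrt (2 * pi * R / b)\<close> is the inverse Gaussian size of
  \<open>tilted\<close> at time R/b, the time that belongs to \<tau> = 1; so every factor of the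
  product tends to 1 at the saddle point.\<close>

definition Laplace_integrand :: "real \<Rightarrow> ('d::finite \<Rightarrow> real) \<Rightarrow> real \<Rightarrow> real \<Rightarrow> real \<Rightarrow> complex" where
  "Laplace_integrand q e b R \<tau> = indicator {0<..} \<tau> *\<^sub>R
     (of_real (\<tau> powr (q - 1) * exp (- Laplace_exponent e b R \<tau>)) *
      (\<Prod>j\<in>UNIV. of_real (sqrt (2 * pi * R / b)) * tilted (R * e j) (R * \<tau> / b)))"

lemma rate_measurable [measurable]: "rate \<in> borel_measurable borel"
  by (intro borel_measurable_continuous_onI DERIV_continuous_on[OF has_field_derivative_at_within[OF DERIV_rate]])

lemma Laplace_integrand_measurable [measurable]: "Laplace_integrand q e b R \<in> borel_measurable borel"
  unfolding Laplace_integrand_def[abs_def] Laplace_exponent_def by measurable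

text \<open>Each bound on \<open>rate\<close> is summed over j, with the squares of the direction
  adding up to 1. The quadratic part gives b R (\<tau>/2 - 1 + 1/(2\<tau>)), a perfect square over
  \<tau>; in the quartic error e_j^4 is replaced by e_j^2. The third bound drops the nonnegative
  term b R \<tau>/2 and stays finite as \<tau> \<rightarrow> 0.\<close>

lemma Laplace_exponent_bounds:
  assumes e: "(\<Sum>j\<in>UNIV. (e j)\<^sup>2) = 1" and b: "b > 0" and R: "R > 0" and \<tau>: "\<tau> > 0"
  shows Laplace_exponent_le: "Laplace_exponent e b R \<tau> \<le> b * R * (\<tau> - 1)\<^sup>2 / (2 * \<tau>)"
    and Laplace_exponent_ge: "Laplace_exponent e b R \<tau> \<ge> b * R * (\<tau> - 1)\<^sup>2 / (2 * \<tau>) - b * R * b\<^sup>2 / (24 * \<tau> ^ 3)"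
    and Laplace_exponent_ge': "Laplace_exponent e b R \<tau> \<ge> b * R * (1 / (2 * (\<tau> + b)) - 1)"
proof -
  have e1: "\<bar>e j\<bar> \<le> 1" for j
  proof -
    have "(e j)\<^sup>2 \<le> (\<Sum>j\<in>UNIV. (e j)\<^sup>2)" by (rule member_le_sum) auto
    then show ?thesis by (simp add: e abs_square_le_1)
  qed
  have sq: "b * R * (\<tau> - 1)\<^sup>2 / (2 * \<tau>) = b * R * (\<tau> / 2 - 1) + b * R / (2 * \<tau>)"
    using \<tau> by (simp add: field_simps power2_eq_square)
  have "(\<Sum>j\<in>UNIV. R * \<tau> / b * rate (b * e j / \<tau>)) \<le> (\<Sum>j\<in>UNIV. R * \<tau> / b * ((b * e j / \<tau>)\<^sup>2 / 2))"
    using b R \<tau> by (intro sum_mono mult_left_mono rate_le) auto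
  also have "\<dots> = (\<Sum>j\<in>UNIV. b * R / (2 * \<tau>) * (e j)\<^sup>2)"
    using b \<tau> by (intro sum.cong) (auto simp: field_simps power2_eq_square)
  also have "\<dots> = b * R / (2 * \<tau>)" unfolding sum_distrib_left[symmetric] e by simp
  finally show "Laplace_exponent e b R \<tau> \<le> b * R * (\<tau> - 1)\<^sup>2 / (2 * \<tau>)"
    unfolding sq Laplace_exponent_def by simp
  have "b * R / (2 * \<tau>) - b * R * b\<^sup>2 / (24 * \<tau> ^ 3) =
      (\<Sum>j\<in>UNIV. (b * R / (2 * \<tau>) - b * R * b\<^sup>2 / (24 * \<tau> ^ 3)) * (e j)\<^sup>2)"
    unfolding sum_distrib_left[symmetric] e by simp
  also have "\<dots> \<le> (\<Sum>j\<in>UNIV. R * \<tau> / b * rate (b * e j / \<tau>))"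
  proof (intro sum_mono)
    fix j
    have "(e j) ^ 4 \<le> (e j)\<^sup>2" using e1[of j] power_decreasing[of 2 4 "\<bar>e j\<bar>"] by simp
    then have "b * R * b\<^sup>2 / (24 * \<tau> ^ 3) * (e j) ^ 4 \<le> b * R * b\<^sup>2 / (24 * \<tau> ^ 3) * (e j)\<^sup>2"
      using b R \<tau> by (intro mult_left_mono) auto
    moreover have "R * \<tau> / b * ((b * e j / \<tau>)\<^sup>2 / 2 - (b * e j / \<tau>) ^ 4 / 24) =
        b * R / (2 * \<tau>) * (e j)\<^sup>2 - b * R * b\<^sup>2 / (24 * \<tau> ^ 3) * (e j) ^ 4"
      using b \<tau> by (simp add: field_simps power2_eq_square power3_eq_cube power4_eq_xxxx)
    moreover have "R * \<tau> / b * ((b * e j / \<tau>)\<^sup>2 / 2 - (b * e j / \<tau>) ^ 4 / 24) \<le> R * \<tau> / b * rate (b * e j / \<tau>)"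
      using b R \<tau> by (intro mult_left_mono rate_ge) auto
    ultimately show "(b * R / (2 * \<tau>) - b * R * b\<^sup>2 / (24 * \<tau> ^ 3)) * (e j)\<^sup>2 \<le> R * \<tau> / b * rate (b * e j / \<tau>)"
      by (simp only: left_diff_distrib)
  qed
  finally show "Laplace_exponent e b R \<tau> \<ge> b * R * (\<tau> - 1)\<^sup>2 / (2 * \<tau>) - b * R * b\<^sup>2 / (24 * \<tau> ^ 3)"
    unfolding sq Laplace_exponent_def by simp
  have "b * R / (2 * (\<tau> + b)) = (\<Sum>j\<in>UNIV. b * R / (2 * (\<tau> + b)) * (e j)\<^sup>2)"
    unfolding sum_distrib_left[symmetric] e by simp
  also have "\<dots> \<le> (\<Sum>j\<in>UNIV. R * \<tau> / b * rate (b * e j / \<tau>))"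
  proof (intro sum_mono)
    fix j
    \<comment> \<open>Bounding the slope by b/\<tau> frees the denominator of j, so that only e_j^2
      remains to be summed.\<close>
    have "\<bar>b * e j / \<tau>\<bar> \<le> b / \<tau>" using b \<tau> e1[of j] by (simp add: abs_mult divide_right_mono)
    then have "(b * e j / \<tau>)\<^sup>2 / (2 * (1 + b / \<tau>)) \<le> (b * e j / \<tau>)\<^sup>2 / (2 * (1 + \<bar>b * e j / \<tau>\<bar>))"
      using b \<tau> by (intro divide_left_mono mult_pos_pos add_pos_nonneg) auto
    also have "\<dots> \<le> rate (b * e j / \<tau>)" by (rule rate_ge_rational)
    finally have "R * \<tau> / b * ((b * e j / \<tau>)\<^sup>2 / (2 * (1 + b / \<tau>))) \<le> R * \<tau> / b * rate (b * e j / \<tau>)"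
      using b R \<tau> by (intro mult_left_mono) auto
    moreover have "R * \<tau> / b * ((b * e j / \<tau>)\<^sup>2 / (2 * (1 + b / \<tau>))) = b * R / (2 * (\<tau> + b)) * (e j)\<^sup>2"
    proof -
      have "1 + b / \<tau> = (\<tau> + b) / \<tau>" using \<tau> by (simp add: field_simps)
      moreover have "\<tau> + b \<noteq> 0" using b \<tau> by simp
      ultimately show ?thesis using b \<tau> by (simp add: power_divide power2_eq_square mult_ac)
    qed
    ultimately show "b * R / (2 * (\<tau> + b)) * (e j)\<^sup>2 \<le> R * \<tau> / b * rate (b * e j / \<tau>)" by simp
  qed
  finally show "Laplace_exponent e b R \<tau> \<ge> b * R * (1 / (2 * (\<tau> + b)) - 1)"
    using b R \<tau> by (simp add: Laplace_exponent_def right_diff_distrib add_increasing)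
qed

lemma powr_le_exp:
  fixes p c :: real
  assumes "p > 0" "c > 0"
  obtains C where "C > 0" "\<And>x. x > 0 \<Longrightarrow> x powr p \<le> C * exp (c * x)"
proof
  \<comment> \<open>This is the maximum of x^p exp(-c x), attained at x = p/c; the tangent of ln at
    that point gives the bound.\<close>
  show "exp (p * (ln (p / c) - 1)) > 0" by simp
  fix x :: real assume x: "x > 0"
  have "ln (x / (p / c)) \<le> x / (p / c) - 1" using assms x by (intro ln_le_minus_one) auto
  moreover have "ln (x / (p / c)) = ln x - ln (p / c)" using assms x by (intro ln_divide_pos) auto
  ultimately have "p * ln x \<le> p * (ln (p / c) - 1 + x / (p / c))" using assms by (intro mult_left_mono) auto
  also have "\<dots> = p * (ln (p / c) - 1) + c * x" using assms by (simp add: field_simps)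
  finally show "x powr p \<le> exp (p * (ln (p / c) - 1)) * exp (c * x)"
    using x by (simp add: powr_def flip: exp_add)
qed

lemma integrable_exp_neg_abs:
  assumes "c > (0::real)" shows "integrable lborel (\<lambda>z. exp (- (c * \<bar>z\<bar>)))"
proof -
  let ?f = "\<lambda>t. indicator {0<..} t * (t powr (1 - 1) * exp (- (c * t))) :: real"
  have f: "integrable lborel ?f"
    using has_bochner_integral_Gamma[of 1 c] assms by (auto intro: integrable.intros)
  \<comment> \<open>The half-line function and its reflection both vanish at 0; the last summand
    restores the value 1 there.\<close>
  have "integrable lborel (\<lambda>z. ?f z + ?f (0 + (-1) * z) + indicator {0} z)"
    by (intro Bochner_Integration.integrable_add f lborel_integrable_real_affine integrable_real_indicator) auto
  moreover have "?f z + ?f (0 + (-1) * z) + indicator {0} z = exp (- (c * \<bar>z\<bar>))" for z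
    by (auto simp: indicator_def)
  ultimately show ?thesis by (simp only:)
qed

lemma norm_Laplace_integrand_le:
  fixes e :: "'d::finite \<Rightarrow> real"
  assumes "\<tau> > 0" "b > 0" "R > 0"
    and c: "\<And>j. sqrt (2 * pi * R / b) * norm (tilted (R * e j) (R * \<tau> / b)) \<le> c"
  shows "norm (Laplace_integrand q e b R \<tau>) \<le> \<tau> powr (q - 1) * exp (- Laplace_exponent e b R \<tau>) * c ^ CARD('d)"
proof -
  have "norm (\<Prod>j\<in>UNIV. of_real (sqrt (2 * pi * R / b)) * tilted (R * e j) (R * \<tau> / b))
     = (\<Prod>j\<in>UNIV. sqrt (2 * pi * R / b) * norm (tilted (R * e j) (R * \<tau> / b)))"
    using assms by (simp add: norm_mult flip: prod_norm)
  also have "\<dots> \<le> (\<Prod>j\<in>(UNIV :: 'd set). c)"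
    using assms by (intro prod_mono) auto
  finally have "norm (\<Prod>j\<in>UNIV. of_real (sqrt (2 * pi * R / b)) * tilted (R * e j) (R * \<tau> / b)) \<le> c ^ CARD('d)"
    by simp
  then show ?thesis
    using assms(1) by (simp add: Laplace_integrand_def norm_mult mult_left_mono)
qed

text \<open>The first bound uses the decay s^(-1/2) of \<open>tilted\<close>, the second only that
  its modulus is at most 1. Neither depends on m, so they apply to every coordinate.\<close>

lemma Laplace_factor_bound:
  obtains K where "K \<ge> 1"
    "\<And>m b R \<tau>. \<lbrakk>\<tau> > 0; b > 0; R > 0\<rbrakk> \<Longrightarrow> sqrt (2 * pi * R / b) * norm (tilted m (R * \<tau> / b)) \<le> K / sqrt \<tau>"
    "\<And>m b R \<tau>. \<lbrakk>\<tau> > 0; b > 0; R > 0\<rbrakk> \<Longrightarrow> sqrt (2 * pi * R / b) * norm (tilted m (R * \<tau> / b)) \<le> K * sqrt (R / b)"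
proof -
  obtain K where K: "K \<ge> 1" "\<And>m s. s > 0 \<Longrightarrow> norm (tilted m s) \<le> K / sqrt s"
    using tilted_bound by blast
  have pi: "sqrt (2 * pi) \<ge> 1" using pi_gt3 by simp
  show ?thesis
  proof (rule that[of "K * sqrt (2 * pi)"])
    show "K * sqrt (2 * pi) \<ge> 1" using mult_mono[OF K(1) pi] K(1) by simp
    fix m b R \<tau> :: real assume *: "\<tau> > 0" "b > 0" "R > 0"
    have "sqrt (2 * pi * R / b) * norm (tilted m (R * \<tau> / b)) \<le> sqrt (2 * pi * R / b) * (K / sqrt (R * \<tau> / b))"
      using * by (intro mult_left_mono K) auto
    also have "\<dots> = K * sqrt (2 * pi) / sqrt \<tau>"
      using * by (simp add: real_sqrt_mult real_sqrt_divide)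
    finally show "sqrt (2 * pi * R / b) * norm (tilted m (R * \<tau> / b)) \<le> K * sqrt (2 * pi) / sqrt \<tau>" .
    have "sqrt (2 * pi * R / b) * norm (tilted m (R * \<tau> / b)) \<le> sqrt (2 * pi * R / b) * 1"
      using * by (intro mult_left_mono norm_tilted_le_one) auto
    also have "\<dots> = 1 * (sqrt (2 * pi) * sqrt (R / b))" by (simp flip: real_sqrt_mult)
    also have "\<dots> \<le> K * (sqrt (2 * pi) * sqrt (R / b))" using * K(1) by (intro mult_right_mono) auto
    finally show "sqrt (2 * pi * R / b) * norm (tilted m (R * \<tau> / b)) \<le> K * sqrt (2 * pi) * sqrt (R / b)"
      by (simp add: mult_ac)
  qed
qed

text \<open>
  For small \<open>\<tau>\<close> neither bound on the factors suffices alone: the first is singular at \<open>\<tau> = 0\<close> and the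
  second is unbounded in \<open>n\<close>. Their minimum is at most a multiple of \<open>b R / (\<tau> + b)\<close>, which the exponent
  absorbs.
\<close>

lemma Laplace_integrand_bound_near_0:
  fixes e :: "'d::finite \<Rightarrow> real"
  assumes e: "(\<Sum>j\<in>UNIV. (e j)\<^sup>2) = 1"
  obtains C where "C > 0"
    "\<And>b R \<tau>. \<lbrakk>0 < b; b \<le> 1 / 8; b * R \<ge> 1; 0 < \<tau>; \<tau> < 1 / 8\<rbrakk> \<Longrightarrow>
       norm (Laplace_integrand q e b R \<tau>) \<le> C * exp (- (b * R / 2)) * \<tau> powr (q - 1)"
proof -
  obtain K where K: "K \<ge> 1"
    "\<And>m b R \<tau>. \<lbrakk>\<tau> > 0; b > 0; R > 0\<rbrakk> \<Longrightarrow> sqrt (2 * pi * R / b) * norm (tilted m (R * \<tau> / b)) \<le> K / sqrt \<tau>"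
    "\<And>m b R \<tau>. \<lbrakk>\<tau> > 0; b > 0; R > 0\<rbrakk> \<Longrightarrow> sqrt (2 * pi * R / b) * norm (tilted m (R * \<tau> / b)) \<le> K * sqrt (R / b)"
    using Laplace_factor_bound by metis
  \<comment> \<open>Half of the decay exp(-y/4) found below pays for the power y^d; the remaining
    exp(-y/8) is at most exp(-b R/2).\<close>
  obtain C where C: "C > 0" "\<And>x. x > 0 \<Longrightarrow> x powr CARD('d) \<le> C * exp (1 / 8 * x)"
    using powr_le_exp[of "CARD('d)" "1/8"] by (metis zero_less_card_finite of_nat_0_less_iff zero_less_divide_1_iff zero_less_numeral)
  show ?thesis
  proof (rule that[of "(2 * K) ^ CARD('d) * C"])
    show "(2 * K) ^ CARD('d) * C > 0" using K(1) C(1) by simp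
    fix b R \<tau> :: real
    assume A: "0 < b" "b \<le> 1 / 8" "b * R \<ge> 1" "0 < \<tau>" "\<tau> < 1 / 8"
    have R: "R > 0" using A by (metis less_le_trans zero_less_one zero_less_mult_pos)
    define u where "u = \<tau> + b"
    define y where "y = b * R / u"
    have u: "0 < u" "u \<le> 1 / 4" using A by (auto simp: u_def)
    have y: "y > 0" using u R A by (simp add: y_def)
    \<comment> \<open>Both \<tau> and b are at most 1/8, hence u \<le> 1/4. Then y/2 - b R, the
      lower bound for the exponent, is at least y/4.\<close>
    have y4: "4 * (b * R) \<le> y" using u A R by (simp add: y_def pos_le_divide_eq)
    have "b * R * (1 / (2 * u) - 1) \<le> Laplace_exponent e b R \<tau>"
      using Laplace_exponent_ge'[OF e A(1) R A(4)] by (simp add: u_def)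
    moreover have "b * R * (1 / (2 * u) - 1) = y / 2 - b * R" by (simp add: y_def right_diff_distrib)
    ultimately have E: "y / 4 \<le> Laplace_exponent e b R \<tau>" using y4 by linarith
    \<comment> \<open>If b \<le> \<tau>, then u \<le> 2\<tau> and 1/sqrt \<tau> \<le> 1/\<tau> \<le>
      2/u. Otherwise u \<le> 2b and sqrt(R/b) \<le> R. Both cases use b R \<ge> 1.\<close>
    have fac: "sqrt (2 * pi * R / b) * norm (tilted (R * e j) (R * \<tau> / b)) \<le> 2 * K * y" for j
    proof (cases "b \<le> \<tau>")
      case True
      have "\<tau> \<le> sqrt \<tau>" using A by (intro real_le_rsqrt) (auto simp: power2_eq_square mult_left_le)
      then have "K / sqrt \<tau> \<le> K / (u / 2)"
        using True A K(1) u by (intro divide_left_mono) (auto simp: u_def)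
      also have "\<dots> = 2 * K * (1 / u)" by simp
      also have "\<dots> \<le> 2 * K * y" unfolding y_def using A u K(1) by (intro mult_left_mono divide_right_mono) auto
      finally show ?thesis using K(2)[OF A(4,1) R, of "R * e j"] by linarith
    next
      case False
      have "sqrt (R / b) \<le> b * R / b"
      proof (rule real_le_lsqrt)
        have "R / b * 1 \<le> R / b * (b * R)" using A R by (intro mult_left_mono) auto
        then show "R / b \<le> (b * R / b)\<^sup>2" using A by (simp add: power2_eq_square)
      qed (use A R in auto)
      also have "b * R / b \<le> b * R / (u / 2)"
        using False A R u by (intro divide_left_mono) (auto simp: u_def)
      finally have "K * sqrt (R / b) \<le> K * (b * R / (u / 2))" using K(1) by (intro mult_left_mono) auto
      also have "\<dots> = 2 * K * y" by (simp add: y_def)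
      finally show ?thesis using K(3)[OF A(4,1) R, of "R * e j"] by linarith
    qed
    have "norm (Laplace_integrand q e b R \<tau>) \<le> \<tau> powr (q - 1) * exp (- Laplace_exponent e b R \<tau>) * (2 * K * y) ^ CARD('d)"
      by (rule norm_Laplace_integrand_le[OF A(4,1) R fac])
    also have "\<dots> \<le> \<tau> powr (q - 1) * exp (- (y / 4)) * (2 * K * y) ^ CARD('d)"
      using E K(1) y by (intro mult_right_mono mult_left_mono) auto
    also have "\<dots> = \<tau> powr (q - 1) * exp (- (y / 4)) * (2 * K) ^ CARD('d) * y powr CARD('d)"
      using y by (simp add: power_mult_distrib powr_realpow)
    also have "\<dots> \<le> \<tau> powr (q - 1) * exp (- (y / 4)) * (2 * K) ^ CARD('d) * (C * exp (1 / 8 * y))"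
      using K(1) C(2)[OF y] by (intro mult_left_mono) auto
    also have "\<dots> = (2 * K) ^ CARD('d) * C * (exp (- (y / 4)) * exp (1 / 8 * y)) * \<tau> powr (q - 1)" by (simp add: mult_ac)
    also have "exp (- (y / 4)) * exp (1 / 8 * y) = exp (- (y / 8))" by (simp flip: exp_add)
    also have "(2 * K) ^ CARD('d) * C * exp (- (y / 8)) * \<tau> powr (q - 1) \<le>
      (2 * K) ^ CARD('d) * C * exp (- (b * R / 2)) * \<tau> powr (q - 1)"
      using y4 K(1) C(1) by (intro mult_right_mono mult_left_mono) (auto simp: mult.commute)
    finally show "norm (Laplace_integrand q e b R \<tau>) \<le> (2 * K) ^ CARD('d) * C * exp (- (b * R / 2)) * \<tau> powr (q - 1)" .
  qed
qed

text \<open>The main term of the exponent is z^2 / (2\<tau>), and \<tau> can be as large as 1 + |z|.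
  So the decay that holds uniformly is exponential in |z|, not Gaussian.\<close>

lemma Laplace_integrand_bound_away_0:
  fixes e :: "'d::finite \<Rightarrow> real"
  assumes e: "(\<Sum>j\<in>UNIV. (e j)\<^sup>2) = 1" and q: "q > 0"
  obtains C where
    "\<And>b R z. \<lbrakk>0 < b; b * R \<ge> 1; b * R * b\<^sup>2 \<le> 1 / 32; 1 + z / sqrt (b * R) \<ge> 1 / 8\<rbrakk> \<Longrightarrow>
       norm (Laplace_integrand q e b R (1 + z / sqrt (b * R))) \<le> C * exp (- (1 / 4 * \<bar>z\<bar>))"
proof -
  obtain K where K: "K \<ge> 1"
    "\<And>m b R \<tau>. \<lbrakk>\<tau> > 0; b > 0; R > 0\<rbrakk> \<Longrightarrow> sqrt (2 * pi * R / b) * norm (tilted m (R * \<tau> / b)) \<le> K / sqrt \<tau>"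
    using Laplace_factor_bound by metis
  obtain C where C: "C > 0" "\<And>x. x > 0 \<Longrightarrow> x powr q \<le> C * exp (1 / 8 * x)"
    using powr_le_exp[of q "1/8"] q by (metis zero_less_divide_1_iff zero_less_numeral)
  show ?thesis
  proof (rule that[of "8 * C * exp 2 * (3 * K) ^ CARD('d)"])
    fix b R z :: real
    assume A: "0 < b" "b * R \<ge> 1" "b * R * b\<^sup>2 \<le> 1 / 32" "1 + z / sqrt (b * R) \<ge> 1 / 8"
    have R: "R > 0" using A by (metis less_le_trans zero_less_one zero_less_mult_pos)
    define \<tau> where "\<tau> = 1 + z / sqrt (b * R)"
    have \<tau>8: "\<tau> \<ge> 1 / 8" using A by (auto simp: \<tau>_def)
    then have \<tau>: "\<tau> > 0" by linarith
    have sq1: "sqrt (b * R) \<ge> 1" using A by simp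
    have "\<bar>z / sqrt (b * R)\<bar> \<le> \<bar>z\<bar>" using sq1 by (simp add: abs_divide divide_le_eq mult_le_cancel_left1)
    then have \<tau>z: "\<tau> \<le> 1 + \<bar>z\<bar>" using abs_ge_self[of "z / sqrt (b * R)"] unfolding \<tau>_def by linarith
    have "b * R * (\<tau> - 1)\<^sup>2 = z\<^sup>2" using A R by (simp add: \<tau>_def power_divide)
    then have sqz: "b * R * (\<tau> - 1)\<^sup>2 / (2 * \<tau>) = z\<^sup>2 / (2 * \<tau>)" by simp
    have "z\<^sup>2 / (2 * \<tau>) \<ge> z\<^sup>2 / (2 * (1 + \<bar>z\<bar>))" using \<tau> \<tau>z by (intro divide_left_mono) auto
    moreover have "z\<^sup>2 / (2 * (1 + \<bar>z\<bar>)) \<ge> (\<bar>z\<bar> - 1) / 2"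
    proof -
      have "(\<bar>z\<bar> - 1) * (1 + \<bar>z\<bar>) \<le> z\<^sup>2" by (simp add: algebra_simps power2_eq_square)
      then show ?thesis by (simp add: field_simps)
    qed
    \<comment> \<open>At \<tau> = 1/8 the denominator is 24/512 = 3/64, which exceeds the assumed
      1/32.\<close>
    moreover have "b * R * b\<^sup>2 / (24 * \<tau> ^ 3) \<le> 1"
    proof -
      have "(1 / 8) ^ 3 \<le> \<tau> ^ 3" using \<tau>8 by (intro power_mono) auto
      then have "b * R * b\<^sup>2 \<le> 24 * \<tau> ^ 3" using A(3) by (simp add: power3_eq_cube)
      then show ?thesis using \<tau> by (simp add: divide_le_eq)
    qed
    ultimately have E: "Laplace_exponent e b R \<tau> \<ge> (\<bar>z\<bar> - 1) / 2 - 1"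
      using Laplace_exponent_ge[OF e A(1) R \<tau>] sqz by linarith
    \<comment> \<open>The exponent q - 1 may be negative. Splitting off 1/\<tau> \<le> 8 leaves the
      positive exponent q, for which \<open>powr\<close> is monotone.\<close>
    have "\<tau> powr (q - 1) = \<tau> powr q / \<tau>" using \<tau> by (simp add: powr_diff)
    also have "\<dots> \<le> \<tau> powr q / (1 / 8)" using \<tau>8 \<tau> by (intro divide_left_mono) auto
    also have "\<dots> \<le> (1 + \<bar>z\<bar>) powr q * 8" using \<tau> \<tau>z q by (simp add: powr_mono2)
    also have "\<dots> \<le> C * exp (1 / 8 * (1 + \<bar>z\<bar>)) * 8" using C(2)[of "1 + \<bar>z\<bar>"] by simp
    finally have p: "\<tau> powr (q - 1) \<le> 8 * C * exp (1 / 8 * (1 + \<bar>z\<bar>))" by simp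
    have fac: "sqrt (2 * pi * R / b) * norm (tilted (R * e j) (R * \<tau> / b)) \<le> 3 * K" for j
    proof -
      have "1 / 3 \<le> sqrt \<tau>" using \<tau>8 by (intro real_le_rsqrt) (auto simp: power2_eq_square)
      then have "K / sqrt \<tau> \<le> K / (1 / 3)" using K(1) \<tau> by (intro divide_left_mono) auto
      then show ?thesis using K(2)[OF \<tau> A(1) R, of "R * e j"] by simp
    qed
    have "norm (Laplace_integrand q e b R \<tau>) \<le> \<tau> powr (q - 1) * exp (- Laplace_exponent e b R \<tau>) * (3 * K) ^ CARD('d)"
      by (rule norm_Laplace_integrand_le[OF \<tau> A(1) R fac])
    also have "\<dots> \<le> (8 * C * exp (1 / 8 * (1 + \<bar>z\<bar>))) * exp (1 - (\<bar>z\<bar> - 1) / 2) * (3 * K) ^ CARD('d)"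
      using p E K(1) C(1) by (intro mult_right_mono mult_mono) auto
    also have "\<dots> = 8 * C * (3 * K) ^ CARD('d) * (exp (1 / 8 * (1 + \<bar>z\<bar>)) * exp (1 - (\<bar>z\<bar> - 1) / 2))" by (simp add: mult_ac)
    \<comment> \<open>The exponents on the left add up to 13/8 - 3|z|/8.\<close>
    also have "exp (1 / 8 * (1 + \<bar>z\<bar>)) * exp (1 - (\<bar>z\<bar> - 1) / 2) \<le> exp 2 * exp (- (1 / 4 * \<bar>z\<bar>))"
      unfolding exp_add[symmetric] exp_le_cancel_iff using abs_ge_zero[of z] by argo
    finally show "norm (Laplace_integrand q e b R (1 + z / sqrt (b * R))) \<le> 8 * C * exp 2 * (3 * K) ^ CARD('d) * exp (- (1 / 4 * \<bar>z\<bar>))"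
      using K(1) C(1) by (simp add: \<tau>_def mult_ac)
  qed
qed

text \<open>With \<tau> = 1 + z / sqrt(b R), the product b R (\<tau> - 1)^2 is exactly z^2, so the
  exponent is squeezed between z^2/(2\<tau>) and the same minus b^3 R / (24 \<tau>^3). The times R
  \<tau> / b tend to infinity and the slopes b e_j / \<tau> to 0, which is what
  \<open>tilted_tendsto\<close> asks for.\<close>

lemma Laplace_integrand_tendsto:
  fixes e :: "'d::finite \<Rightarrow> real" and b R :: "nat \<Rightarrow> real"
  assumes e: "(\<Sum>j\<in>UNIV. (e j)\<^sup>2) = 1"
    and bpos: "\<And>n. b n > 0" and Rpos: "\<And>n. R n > 0" and b0: "b \<longlonglongrightarrow> 0"
    and N: "filterlim (\<lambda>n. b n * R n) at_top sequentially"
    and b3: "(\<lambda>n. b n * R n * (b n)\<^sup>2) \<longlonglongrightarrow> 0"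
  shows "(\<lambda>n. Laplace_integrand q e (b n) (R n) (1 + z / sqrt (b n * R n))) \<longlonglongrightarrow> of_real (exp (- (z\<^sup>2 / 2)))"
proof -
  define \<tau> where "\<tau> n = 1 + z / sqrt (b n * R n)" for n
  have "filterlim (\<lambda>n. sqrt (b n * R n)) at_top sequentially"
    by (rule filterlim_compose[OF sqrt_at_top N])
  then have "(\<lambda>n. z / sqrt (b n * R n)) \<longlonglongrightarrow> 0" by (rule real_tendsto_divide_at_top[OF tendsto_const])
  from tendsto_add[OF tendsto_const[of 1] this] have \<tau>1: "\<tau> \<longlonglongrightarrow> 1" by (simp add: \<tau>_def[abs_def])
  have \<tau>pos: "eventually (\<lambda>n. \<tau> n > 0) sequentially" using order_tendstoD(1)[OF \<tau>1, of 0] by simp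
  have sq: "b n * R n * (\<tau> n - 1)\<^sup>2 = z\<^sup>2" for n
    using bpos[of n] Rpos[of n] by (simp add: \<tau>_def power_divide)
  have L: "(\<lambda>n. z\<^sup>2 / (2 * \<tau> n)) \<longlonglongrightarrow> z\<^sup>2 / (2 * 1)" by (intro tendsto_intros \<tau>1) auto
  have "(\<lambda>n. b n * R n * (b n)\<^sup>2 / (24 * \<tau> n ^ 3)) \<longlonglongrightarrow> 0 / (24 * 1 ^ 3)" by (intro tendsto_intros \<tau>1 b3) auto
  from tendsto_diff[OF L this]
  have L': "(\<lambda>n. z\<^sup>2 / (2 * \<tau> n) - b n * R n * (b n)\<^sup>2 / (24 * \<tau> n ^ 3)) \<longlonglongrightarrow> z\<^sup>2 / 2" by simp
  have E: "(\<lambda>n. Laplace_exponent e (b n) (R n) (\<tau> n)) \<longlonglongrightarrow> z\<^sup>2 / 2"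
  proof (rule tendsto_sandwich[OF _ _ L'])
    show "eventually (\<lambda>n. z\<^sup>2 / (2 * \<tau> n) - b n * R n * (b n)\<^sup>2 / (24 * \<tau> n ^ 3) \<le> Laplace_exponent e (b n) (R n) (\<tau> n)) sequentially"
      using \<tau>pos by eventually_elim (use Laplace_exponent_ge[OF e bpos Rpos] sq in metis)
    show "eventually (\<lambda>n. Laplace_exponent e (b n) (R n) (\<tau> n) \<le> z\<^sup>2 / (2 * \<tau> n)) sequentially"
      using \<tau>pos by eventually_elim (use Laplace_exponent_le[OF e bpos Rpos] sq in metis)
    show "(\<lambda>n. z\<^sup>2 / (2 * \<tau> n)) \<longlonglongrightarrow> z\<^sup>2 / 2" using L by simp
  qed
  \<comment> \<open>Once b < 1, R/b is at least b R and inherits its divergence.\<close>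
  have "eventually (\<lambda>n. b n < 1) sequentially" using order_tendstoD(2)[OF b0, of 1] by simp
  then have "eventually (\<lambda>n. b n * R n \<le> R n / b n) sequentially"
  proof eventually_elim
    case (elim n)
    have "b n * b n \<le> 1" using elim bpos[of n] by (intro mult_le_one) auto
    then have "R n * (b n * b n) \<le> R n * 1" using Rpos[of n] by (intro mult_left_mono) auto
    then show ?case using bpos[of n] by (simp add: pos_le_divide_eq mult_ac)
  qed
  then have Rb: "filterlim (\<lambda>n. R n / b n) at_top sequentially" by (rule filterlim_at_top_mono[OF N])
  have s: "filterlim (\<lambda>n. R n * \<tau> n / b n) at_top sequentially"
    using filterlim_tendsto_pos_mult_at_top[OF \<tau>1 zero_less_one Rb] by (simp add: mult_ac)
  have fac: "(\<lambda>n. of_real (sqrt (2 * pi * R n / b n)) * tilted (R n * e j) (R n * \<tau> n / b n)) \<longlonglongrightarrow> 1" for j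
  proof -
    have "(\<lambda>n. b n * e j / \<tau> n) \<longlonglongrightarrow> 0 * e j / 1" by (intro tendsto_intros b0 \<tau>1) auto
    then have "(\<lambda>n. b n * e j / \<tau> n) \<longlonglongrightarrow> 0" by simp
    moreover have "R n * e j / (R n * \<tau> n / b n) = b n * e j / \<tau> n" for n
      using Rpos[of n] by simp
    ultimately have "(\<lambda>n. R n * e j / (R n * \<tau> n / b n)) \<longlonglongrightarrow> 0" by (simp only:)
    note tilted_tendsto[OF s this]
    moreover have "(\<lambda>n. complex_of_real (1 / sqrt (\<tau> n))) \<longlonglongrightarrow> of_real (1 / sqrt 1)"
      by (intro tendsto_intros \<tau>1) auto
    \<comment> \<open>The factor 1/sqrt \<tau> converts the normalisation at time R \<tau> / b into
      the one at time R/b.\<close>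
    ultimately have "(\<lambda>n. of_real (1 / sqrt (\<tau> n)) * (of_real (sqrt (2 * pi * (R n * \<tau> n / b n))) * tilted (R n * e j) (R n * \<tau> n / b n))) \<longlonglongrightarrow> of_real (1 / sqrt 1) * 1"
      by (intro tendsto_mult)
    then have "(\<lambda>n. of_real (1 / sqrt (\<tau> n)) * (of_real (sqrt (2 * pi * (R n * \<tau> n / b n))) * tilted (R n * e j) (R n * \<tau> n / b n))) \<longlonglongrightarrow> 1"
      by simp
    then show ?thesis
    proof (rule Lim_transform_eventually)
      show "eventually (\<lambda>n. of_real (1 / sqrt (\<tau> n)) * (of_real (sqrt (2 * pi * (R n * \<tau> n / b n))) * tilted (R n * e j) (R n * \<tau> n / b n)) =
         of_real (sqrt (2 * pi * R n / b n)) * tilted (R n * e j) (R n * \<tau> n / b n)) sequentially"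
        using \<tau>pos
      proof eventually_elim
        case (elim n)
        have "1 / sqrt (\<tau> n) * sqrt (2 * pi * (R n * \<tau> n / b n)) = sqrt (2 * pi * R n / b n)"
          using elim by (simp add: real_sqrt_mult real_sqrt_divide)
        then show ?case by (simp only: of_real_mult[symmetric] mult.assoc[symmetric])
      qed
    qed
  qed
  have "(\<lambda>n. \<tau> n powr (q - 1)) \<longlonglongrightarrow> 1 powr (q - 1)" by (intro tendsto_intros \<tau>1) auto
  then have "(\<lambda>n. of_real (\<tau> n powr (q - 1) * exp (- Laplace_exponent e (b n) (R n) (\<tau> n))) *
      (\<Prod>j\<in>UNIV. of_real (sqrt (2 * pi * R n / b n)) * tilted (R n * e j) (R n * \<tau> n / b n)))
     \<longlonglongrightarrow> of_real (1 powr (q - 1) * exp (- (z\<^sup>2 / 2))) * (\<Prod>j\<in>(UNIV :: 'd set). 1)"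
    by (intro tendsto_mult tendsto_of_real tendsto_prod fac tendsto_exp tendsto_minus E)
  then have "(\<lambda>n. of_real (\<tau> n powr (q - 1) * exp (- Laplace_exponent e (b n) (R n) (\<tau> n))) *
      (\<Prod>j\<in>UNIV. of_real (sqrt (2 * pi * R n / b n)) * tilted (R n * e j) (R n * \<tau> n / b n)))
     \<longlonglongrightarrow> of_real (exp (- (z\<^sup>2 / 2)))" by simp
  then have "(\<lambda>n. Laplace_integrand q e (b n) (R n) (\<tau> n)) \<longlonglongrightarrow> of_real (exp (- (z\<^sup>2 / 2)))"
    by (rule Lim_transform_eventually) (use \<tau>pos in eventually_elim, simp add: Laplace_integrand_def)
  then show ?thesis by (simp add: \<tau>_def)
qed

text \<open>Only the part \<tau> \<ge> 1/8 is rescaled to z and treated by dominated convergence.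
  The part below is bounded directly in \<tau>, and its exp(-b R/2) beats the prefactor sqrt(b
  R).\<close>

lemma Laplace_integral_tendsto:
  fixes e :: "'d::finite \<Rightarrow> real" and b R :: "nat \<Rightarrow> real"
  assumes q: "q > 0" and e: "(\<Sum>j\<in>UNIV. (e j)\<^sup>2) = 1"
    and bpos: "\<And>n. b n > 0" and Rpos: "\<And>n. R n > 0" and b0: "b \<longlonglongrightarrow> 0"
    and N: "filterlim (\<lambda>n. b n * R n) at_top sequentially"
    and b3: "(\<lambda>n. b n * R n * (b n)\<^sup>2) \<longlonglongrightarrow> 0"
  shows "(\<lambda>n. of_real (sqrt (b n * R n)) * (LINT \<tau>|lborel. Laplace_integrand q e (b n) (R n) \<tau>)) \<longlonglongrightarrow> of_real (sqrt (2 * pi))"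
proof -
  obtain C1 where C1: "C1 > 0"
    "\<And>b R \<tau>. \<lbrakk>0 < b; b \<le> 1 / 8; b * R \<ge> 1; 0 < \<tau>; \<tau> < 1 / 8\<rbrakk> \<Longrightarrow>
       norm (Laplace_integrand q e b R \<tau>) \<le> C1 * exp (- (b * R / 2)) * \<tau> powr (q - 1)"
    using Laplace_integrand_bound_near_0[OF e] by metis
  obtain C2 where C2:
    "\<And>b R z. \<lbrakk>0 < b; b * R \<ge> 1; b * R * b\<^sup>2 \<le> 1 / 32; 1 + z / sqrt (b * R) \<ge> 1 / 8\<rbrakk> \<Longrightarrow>
       norm (Laplace_integrand q e b R (1 + z / sqrt (b * R))) \<le> C2 * exp (- (1 / 4 * \<bar>z\<bar>))"
    using Laplace_integrand_bound_away_0[OF e q] by metis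
  have "eventually (\<lambda>n. b n < 1 / 8 \<and> b n * R n \<ge> 1 \<and> b n * R n * (b n)\<^sup>2 < 1 / 32) sequentially"
    using order_tendstoD(2)[OF b0, of "1/8"] order_tendstoD(2)[OF b3, of "1/32"] N
    by (intro eventually_conj) (auto simp: filterlim_at_top)
  then obtain n0 where n0: "\<And>n. n \<ge> n0 \<Longrightarrow> b n \<le> 1 / 8" "\<And>n. n \<ge> n0 \<Longrightarrow> b n * R n \<ge> 1"
    "\<And>n. n \<ge> n0 \<Longrightarrow> b n * R n * (b n)\<^sup>2 \<le> 1 / 32"
    unfolding eventually_sequentially by (metis less_imp_le)
  define Lo where "Lo n \<tau> = indicator {..<1/8} \<tau> *\<^sub>R Laplace_integrand q e (b n) (R n) \<tau>" for n and \<tau> :: real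
  define Hi where "Hi n \<tau> = indicator {1/8..} \<tau> *\<^sub>R Laplace_integrand q e (b n) (R n) \<tau>" for n and \<tau> :: real
  define Hz where "Hz n z = Hi n (1 + 1 / sqrt (b n * R n) * z)" for n and z :: real
  have [measurable]: "Lo n \<in> borel_measurable borel" "Hi n \<in> borel_measurable borel" "Hz n \<in> borel_measurable borel" for n
    unfolding Lo_def[abs_def] Hi_def[abs_def] Hz_def[abs_def] by measurable
  \<comment> \<open>On (0, 1/8) the factor exp(-\<tau>) costs at most a factor e, and it makes the
    majorant integrable on the whole half-line with the known value Gamma q.\<close>
  define D where "D \<tau> = indicator {0<..} \<tau> * (\<tau> powr (q - 1) * exp (- (1 * \<tau>)))" for \<tau> :: real
  have D: "has_bochner_integral lborel D (Gamma q)"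
    using has_bochner_integral_Gamma[OF q, of 1] by (simp add: D_def[abs_def])
  have Lo_le: "norm (Lo n \<tau>) \<le> C1 * exp 1 * exp (- (b n * R n / 2)) * D \<tau>" if "n \<ge> n0" for n \<tau>
  proof (cases "0 < \<tau> \<and> \<tau> < 1 / 8")
    case True
    have "norm (Lo n \<tau>) \<le> C1 * exp (- (b n * R n / 2)) * \<tau> powr (q - 1)"
      using True C1(2)[OF bpos n0(1,2)[OF that]] by (simp add: Lo_def)
    also have "\<dots> \<le> C1 * exp (- (b n * R n / 2)) * (exp 1 * (\<tau> powr (q - 1) * exp (- \<tau>)))"
    proof -
      have "1 \<le> exp (1 - \<tau>)" using True by simp
      then have "\<tau> powr (q - 1) * 1 \<le> \<tau> powr (q - 1) * exp (1 - \<tau>)" by (intro mult_left_mono) auto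
      also have "\<dots> = exp 1 * (\<tau> powr (q - 1) * exp (- \<tau>))" by (simp add: exp_diff exp_minus divide_inverse)
      finally show ?thesis using C1(1) by (intro mult_left_mono) auto
    qed
    finally show ?thesis using True by (simp add: D_def mult_ac)
  next
    case False
    then have "Lo n \<tau> = 0" by (auto simp: Lo_def Laplace_integrand_def indicator_def)
    then show ?thesis using C1(1) by (simp add: D_def)
  qed
  have Dint: "integrable lborel (\<lambda>\<tau>. C1 * exp 1 * exp (- (b n * R n / 2)) * D \<tau>)" for n
    using D by (intro integrable_mult_right) (auto intro: integrable.intros)
  have Lo_int: "integrable lborel (Lo n)" if "n \<ge> n0" for n
    by (rule Bochner_Integration.integrable_bound[OF Dint]) (use Lo_le[OF that] in \<open>auto intro: order_trans[OF _ abs_ge_self]\<close>)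
  have Lo_bound: "norm (LINT \<tau>|lborel. Lo n \<tau>) \<le> C1 * exp 1 * exp (- (b n * R n / 2)) * Gamma q" if "n \<ge> n0" for n
    using norm_integral_le[OF Dint _ Lo_le[OF that]] by (simp add: has_bochner_integral_integral_eq[OF D])
  have "((\<lambda>x :: real. sqrt x * exp (- (x / 2))) \<longlongrightarrow> 0) at_top" by real_asymp
  from filterlim_compose[OF this N]
  have "(\<lambda>n. sqrt (b n * R n) * exp (- (b n * R n / 2))) \<longlonglongrightarrow> 0" .
  from tendsto_mult[OF this tendsto_const[of "C1 * exp 1 * Gamma q"]]
  have small: "(\<lambda>n. sqrt (b n * R n) * exp (- (b n * R n / 2)) * (C1 * exp 1 * Gamma q)) \<longlonglongrightarrow> 0" by simp
  have Lo_lim: "(\<lambda>n. of_real (sqrt (b n * R n)) * (LINT \<tau>|lborel. Lo n \<tau>)) \<longlonglongrightarrow> 0"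
  proof (rule Lim_null_comparison[OF _ small])
    show "eventually (\<lambda>n. norm (of_real (sqrt (b n * R n)) * (LINT \<tau>|lborel. Lo n \<tau>)) \<le>
       sqrt (b n * R n) * exp (- (b n * R n / 2)) * (C1 * exp 1 * Gamma q)) sequentially"
      using eventually_ge_at_top[of n0]
    proof eventually_elim
      case (elim n)
      then have "sqrt (b n * R n) * norm (LINT \<tau>|lborel. Lo n \<tau>) \<le> sqrt (b n * R n) * (C1 * exp 1 * exp (- (b n * R n / 2)) * Gamma q)"
        using bpos[of n] Rpos[of n] by (intro mult_left_mono Lo_bound) auto
      then show ?case using bpos[of n] Rpos[of n] by (simp add: norm_mult mult_ac)
    qed
  qed
  have Hz_le: "norm (Hz n z) \<le> \<bar>C2\<bar> * exp (- (1 / 4 * \<bar>z\<bar>))" if "n \<ge> n0" for n z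
  proof (cases "1 + z / sqrt (b n * R n) \<ge> 1 / 8")
    case True
    have "norm (Hz n z) \<le> C2 * exp (- (1 / 4 * \<bar>z\<bar>))"
      using True C2[OF bpos n0(2,3)[OF that] True] by (simp add: Hz_def Hi_def)
    also have "\<dots> \<le> \<bar>C2\<bar> * exp (- (1 / 4 * \<bar>z\<bar>))" by (intro mult_right_mono) auto
    finally show ?thesis .
  next
    case False
    then have "Hz n z = 0" by (simp add: Hz_def Hi_def)
    then show ?thesis by simp
  qed
  have Eint: "integrable lborel (\<lambda>z. \<bar>C2\<bar> * exp (- (1 / 4 * \<bar>z\<bar>)))"
    by (intro integrable_mult_right integrable_exp_neg_abs) auto
  have Hz_int: "integrable lborel (Hz n)" if "n \<ge> n0" for n
    by (rule Bochner_Integration.integrable_bound[OF Eint]) (use Hz_le[OF that] in \<open>auto intro: order_trans[OF _ abs_ge_self]\<close>)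
  have nz: "1 / sqrt (b n * R n) \<noteq> 0" for n using bpos[of n] Rpos[of n] by simp
  have Hi_int: "integrable lborel (Hi n)" if "n \<ge> n0" for n
    using Hz_int[OF that] lborel_integrable_real_affine_iff[OF nz, of "Hi n" 1] by (simp add: Hz_def[abs_def])
  \<comment> \<open>The Jacobian of the substitution is 1 / sqrt(b R), cancelling the
    prefactor.\<close>
  have Hi_eq: "of_real (sqrt (b n * R n)) * (LINT \<tau>|lborel. Hi n \<tau>) = (LINT z|lborel. Hz n z)" for n
    using lborel_integral_real_affine[OF nz, of "Hi n" n 1] bpos[of n] Rpos[of n]
    by (simp add: Hz_def[abs_def] scaleR_conv_of_real field_simps)
  have Hz_lim: "(\<lambda>n. Hz n z) \<longlonglongrightarrow> of_real (exp (- (z\<^sup>2 / 2)))" for z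
  proof -
    have "filterlim (\<lambda>n. sqrt (b n * R n)) at_top sequentially"
      by (rule filterlim_compose[OF sqrt_at_top N])
    then have "(\<lambda>n. z / sqrt (b n * R n)) \<longlonglongrightarrow> 0" by (rule real_tendsto_divide_at_top[OF tendsto_const])
    then have "eventually (\<lambda>n. z / sqrt (b n * R n) > - 7 / 8) sequentially" by (rule order_tendstoD) simp
    then have "eventually (\<lambda>n. Laplace_integrand q e (b n) (R n) (1 + z / sqrt (b n * R n)) = Hz n z) sequentially"
    proof eventually_elim
      case (elim n)
      then have "1 + z / sqrt (b n * R n) \<ge> 1 / 8" by linarith
      then show ?case by (simp add: Hz_def Hi_def)
    qed
    from Lim_transform_eventually[OF Laplace_integrand_tendsto[OF e bpos Rpos b0 N b3] this] show ?thesis .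
  qed
  have "(\<lambda>n. LINT z|lborel. Hz (n + n0) z) \<longlonglongrightarrow> (LINT z|lborel. complex_of_real (exp (- (z\<^sup>2 / 2))))"
    by (rule integral_dominated_convergence[where w="\<lambda>z. \<bar>C2\<bar> * exp (- (1 / 4 * \<bar>z\<bar>))"])
       (use LIMSEQ_ignore_initial_segment[OF Hz_lim] Hz_le Eint in auto)
  then have "(\<lambda>n. LINT z|lborel. Hz n z) \<longlonglongrightarrow> of_real (sqrt (2 * pi))"
    unfolding integral_complex_of_real integral_exp_neg_half_square by (rule LIMSEQ_offset)
  from tendsto_add[OF Lo_lim this]
  have "(\<lambda>n. of_real (sqrt (b n * R n)) * (LINT \<tau>|lborel. Lo n \<tau>) + (LINT z|lborel. Hz n z)) \<longlonglongrightarrow> of_real (sqrt (2 * pi))" by simp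
  then show ?thesis
  proof (rule Lim_transform_eventually)
    show "eventually (\<lambda>n. of_real (sqrt (b n * R n)) * (LINT \<tau>|lborel. Lo n \<tau>) + (LINT z|lborel. Hz n z) =
      of_real (sqrt (b n * R n)) * (LINT \<tau>|lborel. Laplace_integrand q e (b n) (R n) \<tau>)) sequentially"
      using eventually_ge_at_top[of n0]
    proof eventually_elim
      case (elim n)
      have "Laplace_integrand q e (b n) (R n) \<tau> = Lo n \<tau> + Hi n \<tau>" for \<tau>
        by (simp add: Lo_def Hi_def indicator_def)
      then have "(LINT \<tau>|lborel. Laplace_integrand q e (b n) (R n) \<tau>) = (LINT \<tau>|lborel. Lo n \<tau>) + (LINT \<tau>|lborel. Hi n \<tau>)"
        by (simp add: Lo_int[OF elim] Hi_int[OF elim])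
      then show ?case by (simp add: ring_distribs flip: Hi_eq)
    qed
  qed
qed

section \<open>Scaling, prefactor and conclusion\<close>

text \<open>To leading order the exponent is a^2 t + d R^2 / (2t), minimal at t = d R / b with value
  b R. The substitution t = c \<tau> with c = d R / b moves this minimum to \<tau> = 1. The identity
  is exact, and the (2 pi)^d from the coordinates cancels that of the Green function.\<close>

lemma lattice_green_eq_Laplace_integrand:
  fixes y :: "int ^ 'd"
  assumes q: "q > 0" and a: "a > 0" and y: "y \<noteq> 0"
  defines "R \<equiv> norm (real_vec y)" and "b \<equiv> sqrt (2 * real CARD('d)) * a"
  shows "lattice_green q a y =
    of_real ((real CARD('d) * R / b) powr q * exp (- (b * R)) / (sqrt (2 * pi * R / b) ^ CARD('d) * Gamma q)) *
    (LINT \<tau>|lborel. Laplace_integrand q (\<lambda>j. of_int (y $ j) / R) b R \<tau>)"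
proof -
  define d where "d = real CARD('d)"
  define e where "e j = of_int (y $ j) / R" for j
  define c where "c = d * R / b"
  have d: "d > 0" by (simp add: d_def)
  have "real_vec y \<noteq> 0" using y by (auto simp: real_vec_def vec_eq_iff)
  then have R: "R > 0" by (simp add: R_def)
  have b: "b > 0" using a d by (simp add: b_def d_def)
  have c: "c > 0" using d R b by (simp add: c_def)
  have a2: "a\<^sup>2 = b\<^sup>2 / (2 * d)" using d by (simp add: b_def d_def power_mult_distrib)
  define H where "H t = indicator {0<..} t *\<^sub>R (of_real (t powr (q - 1) * exp (- (a\<^sup>2 * t))) *
       (\<Prod>j\<in>UNIV. fourier_exp_cos (y $ j) (t / d)))" for t
  define S where "S = sqrt (2 * pi * R / b)"
  have S: "S > 0" using R b by (simp add: S_def)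
  have H: "H (0 + c * \<tau>) = of_real (c powr (q - 1) * exp (- (b * R)) * (2 * pi) ^ CARD('d) / S ^ CARD('d)) *
      Laplace_integrand q e b R \<tau>" for \<tau>
  proof (cases "\<tau> > 0")
    case True
    define s where "s = R * \<tau> / b"
    have s: "s > 0" using True R b by (simp add: s_def)
    have cs: "c * \<tau> / d = s" using d by (simp add: c_def s_def)
    have "fourier_exp_cos (y $ j) s = of_real (2 * pi) * (of_real (exp (- (s * rate (b * e j / \<tau>)))) * tilted (R * e j) s)" for j
    proof -
      have "of_int (y $ j) / s = b * e j / \<tau>" "of_int (y $ j) = R * e j" using R b by (auto simp: s_def e_def)
      then show ?thesis unfolding fourier_exp_cos_eq_tilted[OF s] by (simp add: mult_ac)
    qed
    then have P1: "(\<Prod>j\<in>UNIV. fourier_exp_cos (y $ j) s) = of_real (2 * pi) ^ CARD('d) *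
        (of_real (exp (- (\<Sum>j\<in>UNIV. s * rate (b * e j / \<tau>)))) * (\<Prod>j\<in>UNIV. tilted (R * e j) s))"
      by (simp only: prod.distrib prod_constant exp_sum[symmetric] of_real_prod[symmetric] sum_negf[symmetric] finite_class.finite_UNIV)
    have P2: "(\<Prod>j\<in>UNIV. of_real S * tilted (R * e j) s) = of_real S ^ CARD('d) * (\<Prod>j\<in>UNIV. tilted (R * e j) s)"
      by (simp only: prod.distrib prod_constant)
    have "a\<^sup>2 * (c * \<tau>) = b * R * \<tau> / 2"
      unfolding a2 c_def using b d by (simp add: power2_eq_square)
    then have "exp (- (a\<^sup>2 * (c * \<tau>))) * exp (- (\<Sum>j\<in>UNIV. s * rate (b * e j / \<tau>))) =
        exp (- (b * R)) * exp (- Laplace_exponent e b R \<tau>)"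
      unfolding exp_add[symmetric] Laplace_exponent_def s_def by (simp add: algebra_simps)
    then have ex: "of_real (exp (- (a\<^sup>2 * (c * \<tau>)))) * of_real (exp (- (\<Sum>j\<in>UNIV. s * rate (b * e j / \<tau>)))) =
        (of_real (exp (- (b * R))) * of_real (exp (- Laplace_exponent e b R \<tau>)) :: complex)"
      by (simp only: of_real_mult[symmetric])
    have "H (0 + c * \<tau>) = of_real ((c * \<tau>) powr (q - 1)) * of_real (2 * pi) ^ CARD('d) *
        (of_real (exp (- (a\<^sup>2 * (c * \<tau>)))) * of_real (exp (- (\<Sum>j\<in>UNIV. s * rate (b * e j / \<tau>))))) *
        (\<Prod>j\<in>UNIV. tilted (R * e j) s)"
    proof -
      have "H (0 + c * \<tau>) = of_real ((c * \<tau>) powr (q - 1) * exp (- (a\<^sup>2 * (c * \<tau>)))) * (\<Prod>j\<in>UNIV. fourier_exp_cos (y $ j) s)"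
        using True c unfolding H_def add_0_left cs by simp
      then show ?thesis unfolding P1 by (simp add: mult_ac)
    qed
    also have "\<dots> = of_real (c powr (q - 1)) * of_real (\<tau> powr (q - 1)) * of_real (2 * pi) ^ CARD('d) *
        (of_real (exp (- (b * R))) * of_real (exp (- Laplace_exponent e b R \<tau>))) * (\<Prod>j\<in>UNIV. tilted (R * e j) s)"
      unfolding ex using c True by (simp add: powr_mult)
    also have "\<dots> = of_real (c powr (q - 1) * exp (- (b * R)) * (2 * pi) ^ CARD('d) / S ^ CARD('d)) *
      Laplace_integrand q e b R \<tau>"
      using True S by (simp add: Laplace_integrand_def P2 flip: s_def S_def)
    finally show ?thesis .
  next
    case False
    then have "\<not> 0 < c * \<tau>" using c by (simp add: zero_less_mult_iff)
    then show ?thesis using False by (simp add: H_def Laplace_integrand_def)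
  qed
  have "(LINT t|lborel. H t) = \<bar>c\<bar> *\<^sub>R (LINT \<tau>|lborel. H (0 + c * \<tau>))"
    using c by (intro lborel_integral_real_affine) auto
  also have "\<dots> = of_real (c * (c powr (q - 1) * exp (- (b * R)) * (2 * pi) ^ CARD('d) / S ^ CARD('d))) *
      (LINT \<tau>|lborel. Laplace_integrand q e b R \<tau>)"
    unfolding H integral_mult_right_zero using c by (simp only: scaleR_conv_of_real of_real_mult abs_of_pos mult.assoc)
  also have "c * (c powr (q - 1) * exp (- (b * R)) * (2 * pi) ^ CARD('d) / S ^ CARD('d)) =
     (c powr q * exp (- (b * R)) / (S ^ CARD('d) * Gamma q)) * ((2 * pi) ^ CARD('d) * Gamma q)"
    using c S Gamma_real_pos[OF q] by (simp add: powr_diff)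
  finally have "(LINT t|lborel. H t) / of_real ((2 * pi) ^ CARD('d) * Gamma q) =
    of_real (c powr q * exp (- (b * R)) / (S ^ CARD('d) * Gamma q)) * (LINT \<tau>|lborel. Laplace_integrand q e b R \<tau>)"
    using Gamma_real_pos[OF q] by simp
  then show ?thesis
    unfolding lattice_green_eq_Laplace[OF q a] H_def[folded d_def] by (simp only: H_def[abs_def] d_def c_def S_def e_def[abs_def])
qed

text \<open>The sqrt(2 pi) is the Gaussian integral of Laplace's method and sqrt(b R) its width;
  both sides are then monomials. The exponent of R is q - d/2 - 1/2, that of b is d/2 - 1/2 - q, and
  one power of sqrt(2 pi) is gained, whence the d - 1 in \<open>green_const\<close>.\<close>

lemma green_prefactor_eq:
  fixes b R q :: real and d :: nat
  assumes "b > 0" "R > 0" "d > 0" "q > 0"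
  shows "sqrt (2 * pi) * ((real d * R / b) powr q / (sqrt (2 * pi * R / b) ^ d * Gamma q)) =
    sqrt (b * R) * (green_const d q * (b powr ((real d - 1 - 2 * q) / 2) / R powr ((real d + 1 - 2 * q) / 2)))"
proof -
  define G where "G = Gamma q"
  define P where "P = 2 * pi"
  have P: "P > 0" by (simp add: P_def)
  have s: "sqrt (P * R / b) ^ d = (P * R / b) powr (real d / 2)"
    using assms P by (simp add: powr_half_sqrt[symmetric] powr_powr flip: powr_realpow)
  have r: "sqrt P = P powr (1 / 2)" "sqrt (b * R) = (b * R) powr (1 / 2)"
    using assms P by (simp_all add: powr_half_sqrt)
  have "P powr (1 / 2) * ((real d * R / b) powr q / (P * R / b) powr (real d / 2)) =
    (b * R) powr (1 / 2) * (real d powr q / P powr ((real d - 1) / 2) * (b powr ((real d - 1 - 2 * q) / 2) / R powr ((real d + 1 - 2 * q) / 2)))"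
    using assms P
    by (simp add: powr_def ln_mult ln_div flip: exp_add exp_diff) (simp add: field_simps)
  then show ?thesis
    unfolding green_const_def P_def[symmetric] G_def[symmetric] s r
    by (metis (no_types, opaque_lifting) divide_divide_eq_left times_divide_eq_left times_divide_eq_right mult.commute)
qed

theorem mainTheorem3:
  fixes q :: real and x :: "int ^ 'd" and a :: "nat \<Rightarrow> real"
  assumes "q > 0"
    and "x \<noteq> 0"
    and "\<And>n. n \<ge> 1 \<Longrightarrow> a n > 0"
    and "a \<longlonglongrightarrow> 0"
    and "filterlim (\<lambda>n. a n * real n) at_top sequentially"
    and "(\<lambda>n. a n ^ 3 * real n) \<longlonglongrightarrow> 0"
  shows "(\<lambda>n. lattice_green q (a n) (int n *s x)) \<sim>[sequentially]
         (\<lambda>n. complex_of_real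
           (green_const CARD('d) q
            * ((sqrt (2 * real CARD('d)) * a n) powr ((real CARD('d) - 1 - 2 * q) / 2)
               / (real n * norm (real_vec x)) powr ((real CARD('d) + 1 - 2 * q) / 2))
            * exp (- (sqrt (2 * real CARD('d)) * a n * real n * norm (real_vec x)))))"
proof -
  define w where "w = sqrt (2 * real CARD('d))"
  define r where "r = norm (real_vec x)"
  define e where "e j = of_int (x $ j) / r" for j
  define b where "b n = w * a n" for n
  define R where "R n = real n * r" for n
  define I where "I n = (LINT \<tau>|lborel. Laplace_integrand q e (b n) (R n) \<tau>)" for n
  have w: "w > 0" by (simp add: w_def)
  have "real_vec x \<noteq> 0" using assms(2) by (auto simp: real_vec_def vec_eq_iff)
  then have r: "r > 0" by (simp add: r_def)
  have pos: "b n > 0" "R n > 0" if "n \<ge> 1" for n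
    using assms(3)[OF that] that w r by (auto simp: b_def R_def)
  have "(\<Sum>j\<in>UNIV. (real_of_int (x $ j))\<^sup>2) = r\<^sup>2"
    by (simp add: r_def norm_vec_def L2_set_def real_vec_def sum_nonneg)
  then have e: "(\<Sum>j\<in>UNIV. (e j)\<^sup>2) = 1"
    using r by (simp add: e_def power_divide flip: sum_divide_distrib)
  have b0: "b \<longlonglongrightarrow> 0"
    using tendsto_mult[OF tendsto_const[of w] assms(4)] by (simp add: b_def[abs_def])
  have N: "filterlim (\<lambda>n. b n * R n) at_top sequentially"
    using filterlim_tendsto_pos_mult_at_top[OF tendsto_const[of "w * r"] _ assms(5)] w r
    by (simp add: b_def R_def mult_ac)
  \<comment> \<open>The expression equals w^3 r a_n^3 n.\<close>
  have b3: "(\<lambda>n. b n * R n * (b n)\<^sup>2) \<longlonglongrightarrow> 0"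
    using tendsto_mult[OF tendsto_const[of "w ^ 3 * r"] assms(6)]
    by (simp add: b_def R_def power2_eq_square power3_eq_cube mult_ac)
  \<comment> \<open>Positivity is available only from n = 1 on (R vanishes at n = 0), while
    \<open>Laplace_integral_tendsto\<close> wants it at every index.\<close>
  have "(\<lambda>n. of_real (sqrt (b (n + 1) * R (n + 1))) * I (n + 1)) \<longlonglongrightarrow> of_real (sqrt (2 * pi))"
    unfolding I_def
    by (intro Laplace_integral_tendsto[OF assms(1) e] pos LIMSEQ_ignore_initial_segment[OF b0]
        LIMSEQ_ignore_initial_segment[OF b3] filterlim_compose[OF N filterlim_add_const_nat_at_top]) auto
  then have "(\<lambda>n. of_real (sqrt (b n * R n)) * I n) \<longlonglongrightarrow> of_real (sqrt (2 * pi))" by (rule LIMSEQ_offset)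
  from tendsto_divide[OF this tendsto_const[of "of_real (sqrt (2 * pi))"]]
  have lim: "(\<lambda>n. of_real (sqrt (b n * R n)) * I n / of_real (sqrt (2 * pi))) \<longlonglongrightarrow> 1" by simp
  show ?thesis
  proof (rule asymp_equivI', rule Lim_transform_eventually[OF lim])
    show "eventually (\<lambda>n. of_real (sqrt (b n * R n)) * I n / of_real (sqrt (2 * pi)) =
       lattice_green q (a n) (int n *s x) / complex_of_real
           (green_const CARD('d) q
            * ((sqrt (2 * real CARD('d)) * a n) powr ((real CARD('d) - 1 - 2 * q) / 2)
               / (real n * norm (real_vec x)) powr ((real CARD('d) + 1 - 2 * q) / 2))
            * exp (- (sqrt (2 * real CARD('d)) * a n * real n * norm (real_vec x))))) sequentially"
      using eventually_ge_at_top[of 1]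
    proof eventually_elim
      case (elim n)
      note p = pos[OF elim]
      have rv: "real_vec (int n *s x) = real n *\<^sub>R real_vec x" by (simp add: real_vec_def vec_eq_iff)
      then have nR: "norm (real_vec (int n *s x)) = R n" by (simp add: R_def r_def)
      have nz: "int n *s x \<noteq> 0" using assms(2) elim by (auto simp: vec_eq_iff)
      \<comment> \<open>The direction of n x does not depend on n, so a single \<open>e\<close>
        serves the whole sequence.\<close>
      have ee: "(\<lambda>j. of_int ((int n *s x) $ j) / R n) = e"
        using elim r by (auto simp: e_def R_def fun_eq_iff)
      define Q where "Q = (real CARD('d) * R n / b n) powr q / (sqrt (2 * pi * R n / b n) ^ CARD('d) * Gamma q)"
      define G where "G = green_const CARD('d) q * (b n powr ((real CARD('d) - 1 - 2 * q) / 2) / R n powr ((real CARD('d) + 1 - 2 * q) / 2))"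
      have QG: "sqrt (2 * pi) * Q = sqrt (b n * R n) * G"
        unfolding Q_def G_def using p assms(1) by (intro green_prefactor_eq) auto
      have "Gamma q > 0" using assms(1) by (rule Gamma_real_pos)
      then have G: "G > 0" using p by (auto simp: G_def green_const_def intro!: mult_pos_pos divide_pos_pos)
      have L: "lattice_green q (a n) (int n *s x) = of_real (Q * exp (- (b n * R n))) * I n"
        using lattice_green_eq_Laplace_integrand[OF assms(1) assms(3)[OF elim] nz]
        unfolding nR w_def[symmetric] b_def[symmetric] ee by (simp add: Q_def I_def)
      have Q: "Q = sqrt (b n * R n) * G / sqrt (2 * pi)" using QG by (simp add: field_simps)
      have "lattice_green q (a n) (int n *s x) / of_real (G * exp (- (b n * R n))) =
         of_real (sqrt (b n * R n)) * I n / of_real (sqrt (2 * pi))"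
        unfolding L Q using G by simp
      then show ?case
        by (simp add: G_def b_def R_def r_def w_def mult.assoc)
    qed
  qed
qed

end
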